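(* Let $F\colon\mathbf{W}\to\mathbf{E}$ be a $C^1$-map between Euclidean spaces and let $\bar x\in\mathbf{W}$. Let $\mathcal{X},\mathcal{Y}\subset\mathbf{E}$ be two locally closed sets with $\mathcal{Y}$ Clarke regular and containing $F(\bar x)$. Suppose that the transversality condition holds: $$N_{\mathcal{Y}}(F(\bar x))\cap\mathrm{Null}(\nabla F(\bar x)^* )=\{0\}.$$ Let $\diamond$ be any of the symbols $\le,=,\ge$. Then the following are true. 1. If $\mathcal{X}$ is $(a)$-regular along $\mathcal{Y}$ near $F(\bar x)$, then $F^{-1}(\mathcal{X})$ is $(a)$-regular along $F^{-1}(\mathcal{Y})$ near $\bar x$. 2. If $\mathcal{X}$ is $(a)$-regular and $(b_\diamond)$-regular along $\mathcal{Y}$ near $F(\bar x)$, then $F^{-1}(\mathcal{X})$ is $(b_\diamond)$-regular along $F^{-1}(\mathcal{Y})$ near $\bar x$. If in addition $F$ is $C^2$-smooth, then the following are true. 3. If $\mathcal{X}$ is strongly $(a)$-regular along $\mathcal{Y}$ near $F(\bar x)$, then $F^{-1}(\mathcal{X})$ is strongly $(a)$-regular along $F^{-1}(\mathcal{Y})$ near $\bar x$. 4. If $\mathcal{X}$ is both $(a)$-regular and strongly $(b_\diamond)$-regular along $\mathcal{Y}$ near $F(\bar x)$, then $F^{-1}(\mathcal{X})$ is strongly $(b_\diamond)$-regular along $F^{-1}(\mathcal{Y})$ near $\bar x$.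
   Context: $\mathbf{B}$ is the closed unit ball. The Fréchet normal cone $\hat N_Q(x)$ to $Q$ at $x\in Q$ is the set of $v$ with $\langle v,y-x\rangle\le o(\|y-x\|)$ as $y\to x$ in $Q$; the limiting normal cone $N_Q(x)$ consists of limits of $v_i\in\hat N_Q(x_i)$ with $x_i\to x$ in $Q$; $N_Q^c(x)=\mathrm{cl}\,\mathrm{conv}\,N_Q(x)$. $Q$ is Clarke regular at $x$ if it is locally closed around $x$ and $N^c_Q(x)=\hat N_Q(x)$; $Q$ is Clarke regular if this holds at each of its points. $\Delta(U,V)=\sup\{\mathrm{dist}(u,V):u\in U,\|u\|=1\}$ for closed cones $U,V$. Regularity of $\mathcal{X}$ along $\mathcal{Y}$: (a): for any $x_i\in\mathcal{X}$ converging to $y\in\mathcal{Y}$ and $v_i\in N_{\mathcal{X}}(x_i)$, every limit point of $v_i$ lies in $N_{\mathcal{Y}}(y)$. $(b_\le)$, $(b_\ge)$, $(b_=)$: for all $x\in\mathcal{X}$, $y\in\mathcal{Y}$, $v\in N_{\mathcal{X}}(x)\cap\mathbf{B}$ one has, respectively, $\langle v,y-x\rangle\le o(\|y-x\|)$, $\ge o(\|y-x\|)$, $=o(\|y-x\|)$, where $o(\cdot)$ is a univariate error with $o(t)/t\to0$ as $t\searrow0$. strong (a): there is $C>0$ with $\Delta(N_{\mathcal{X}}(x),N_{\mathcal{Y}}(y))\le C\|x-y\|$ for all $x\in\mathcal{X}$, $y\in\mathcal{Y}$. strong $(b_\le)$, $(b_\ge)$, $(b_=)$: there is $C>0$ such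 that for all such $x,y,v$ one has, respectively, $\langle v,y-x\rangle\le C\|x-y\|^2$, $\langle v,y-x\rangle\ge-C\|x-y\|^2$, $|\langle v,y-x\rangle|\le C\|x-y\|^2$. Each property holds near $\bar z\in\mathcal{Y}$ if it holds for $\mathcal{X}\cap U$ along $\mathcal{Y}\cap U$ for some neighborhood $U$ of $\bar z$. *)

theory Defs
  imports "HOL-Analysis.Analysis"
begin

section \<open>Normal cones\<close>

text \<open>All cones below are meant at points \<open>x \<in> Q\<close>; their values at other points are junk.\<close>

definition frechet_normal_cone :: "'a::euclidean_space set \<Rightarrow> 'a \<Rightarrow> 'a set" where
  "frechet_normal_cone Q x =
     {v. \<forall>\<epsilon>>0. eventually (\<lambda>y. v \<bullet> (y - x) \<le> \<epsilon> * norm (y - x)) (at x within Q)}"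

definition limiting_normal_cone :: "'a::euclidean_space set \<Rightarrow> 'a \<Rightarrow> 'a set" where
  "limiting_normal_cone Q x =
     {v. \<exists>xs vs. (\<forall>i::nat. xs i \<in> Q \<and> vs i \<in> frechet_normal_cone Q (xs i))
                 \<and> xs \<longlonglongrightarrow> x \<and> vs \<longlonglongrightarrow> v}"

definition clarke_normal_cone :: "'a::euclidean_space set \<Rightarrow> 'a \<Rightarrow> 'a set" where
  "clarke_normal_cone Q x = closure (convex hull limiting_normal_cone Q x)"

definition locally_closed_at :: "'a::euclidean_space set \<Rightarrow> 'a \<Rightarrow> bool" where
  "locally_closed_at Q x \<longleftrightarrow> (\<exists>r>0. closed (cball x r \<inter> Q))"

text \<open>The pointwise notion agrees with the library's \<open>locally closed\<close>.\<close>

lemma locally_closed_iff: "locally closed Q \<longleftrightarrow> (\<forall>x\<in>Q. locally_closed_at Q x)"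
  for Q :: "'a::euclidean_space set"
  by (simp add: locally_closed locally_compact_Int_cball locally_closed_at_def)

definition clarke_regular_at :: "'a::euclidean_space set \<Rightarrow> 'a \<Rightarrow> bool" where
  "clarke_regular_at Q x \<longleftrightarrow>
     locally_closed_at Q x \<and> clarke_normal_cone Q x = frechet_normal_cone Q x"

definition clarke_regular :: "'a::euclidean_space set \<Rightarrow> bool" where
  "clarke_regular Q \<longleftrightarrow> (\<forall>x\<in>Q. clarke_regular_at Q x)"

text \<open>The gap \<open>\<Delta>(U,V)\<close> between cones. If \<open>U\<close> has no unit vector the supremum is over the
  empty set, which is \<open>0\<close> by the usual convention for suprema of nonnegative quantities, but
  is unspecified for the library's \<open>Sup\<close> on reals.\<close>

definition cone_gap :: "'a::euclidean_space set \<Rightarrow> 'a set \<Rightarrow> real" where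
  "cone_gap U V = (if U \<inter> sphere 0 1 = {} then 0 else (SUP u\<in>U \<inter> sphere 0 1. infdist u V))"

section \<open>Regularity of one set along another\<close>

definition a_regular :: "'a::euclidean_space set \<Rightarrow> 'a set \<Rightarrow> bool" where
  "a_regular X Y \<longleftrightarrow>
     (\<forall>xs vs y v. (\<forall>i::nat. xs i \<in> X \<and> vs i \<in> limiting_normal_cone X (xs i))
        \<and> y \<in> Y \<and> xs \<longlonglongrightarrow> y \<and> (\<exists>r. strict_mono r \<and> (vs \<circ> r) \<longlonglongrightarrow> v)
        \<longrightarrow> v \<in> limiting_normal_cone Y y)"

definition strongly_a_regular :: "'a::euclidean_space set \<Rightarrow> 'a set \<Rightarrow> bool" where
  "strongly_a_regular X Y \<longleftrightarrow>
     (\<exists>C>0. \<forall>x\<in>X. \<forall>y\<in>Y.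
        cone_gap (limiting_normal_cone X x) (limiting_normal_cone Y y) \<le> C * norm (x - y))"

datatype b_symbol = Le | Eq | Ge

text \<open>\<open>b_bound \<diamond> s e\<close> is the reading of \<open>s \<diamond> e\<close> for an error term \<open>e\<close>: errors have arbitrary
  sign in \<open>s \<ge> o(t)\<close>, so the sign there is immaterial, and \<open>s = o(t)\<close> means \<open>\<bar>s\<bar> \<le> o(t)\<close>.\<close>

fun b_bound :: "b_symbol \<Rightarrow> real \<Rightarrow> real \<Rightarrow> bool" where
  "b_bound Le s e \<longleftrightarrow> s \<le> e"
| "b_bound Eq s e \<longleftrightarrow> \<bar>s\<bar> \<le> e"
| "b_bound Ge s e \<longleftrightarrow> s \<ge> - e"

text \<open>A single univariate error function serves all \<open>x\<close>, \<open>y\<close>, \<open>v\<close>.\<close>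

definition b_regular :: "b_symbol \<Rightarrow> 'a::euclidean_space set \<Rightarrow> 'a set \<Rightarrow> bool" where
  "b_regular d X Y \<longleftrightarrow>
     (\<exists>err :: real \<Rightarrow> real. ((\<lambda>t. err t / t) \<longlongrightarrow> 0) (at_right 0) \<and>
        (\<forall>x\<in>X. \<forall>y\<in>Y. \<forall>v \<in> limiting_normal_cone X x \<inter> cball 0 1.
           b_bound d (v \<bullet> (y - x)) (err (norm (y - x)))))"

definition strongly_b_regular :: "b_symbol \<Rightarrow> 'a::euclidean_space set \<Rightarrow> 'a set \<Rightarrow> bool" where
  "strongly_b_regular d X Y \<longleftrightarrow>
     (\<exists>C>0. \<forall>x\<in>X. \<forall>y\<in>Y. \<forall>v \<in> limiting_normal_cone X x \<inter> cball 0 1.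
        b_bound d (v \<bullet> (y - x)) (C * (norm (x - y))\<^sup>2))"

definition holds_near ::
    "('a::euclidean_space set \<Rightarrow> 'a set \<Rightarrow> bool) \<Rightarrow> 'a set \<Rightarrow> 'a set \<Rightarrow> 'a \<Rightarrow> bool" where
  "holds_near P X Y z \<longleftrightarrow> (\<exists>U. open U \<and> z \<in> U \<and> P (X \<inter> U) (Y \<inter> U))"

section \<open>Smooth maps\<close>

definition C1_map :: "('w::euclidean_space \<Rightarrow> 'e::euclidean_space) \<Rightarrow> bool" where
  "C1_map F \<longleftrightarrow>
     (\<exists>F' :: 'w \<Rightarrow> 'w \<Rightarrow>\<^sub>L 'e.
        (\<forall>x. (F has_derivative blinfun_apply (F' x)) (at x)) \<and> continuous_on UNIV F')"

definition C2_map :: "('w::euclidean_space \<Rightarrow> 'e::euclidean_space) \<Rightarrow> bool" where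
  "C2_map F \<longleftrightarrow>
     (\<exists>(F' :: 'w \<Rightarrow> 'w \<Rightarrow>\<^sub>L 'e) (F'' :: 'w \<Rightarrow> 'w \<Rightarrow>\<^sub>L ('w \<Rightarrow>\<^sub>L 'e)).
        (\<forall>x. (F has_derivative blinfun_apply (F' x)) (at x)) \<and>
        (\<forall>x. (F' has_derivative blinfun_apply (F'' x)) (at x)) \<and> continuous_on UNIV F'')"

end

(* Penalising the constraint F z \<in> X shows that normals to F^-1(X) are images F'(x)^* v of normals v to X,
   provided |F'(z)^* v| \<ge> c |v| for all normals v to X near the base point. That bound follows from
   (a)-regularity and transversality by compactness: normalised counterexamples would converge to
   a unit normal of Y annihilated by the adjoint. In the other direction F'(y)^* maps the normals of Y
   to normals of F^-1(Y), because Y is Clarke regular. Each regularity condition then transfers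
   through w = F'(x)^* v with |v| \<le> |w| / c and the linearisation
   <w, y - x> = <v, F(y) - F(x)> + o(|y - x|), whose error is quadratic when F' is locally Lipschitz. *)

theory Submission
  imports Defs
begin

section \<open>Normal cones\<close>

text \<open>The multiplier of a Frechet normal of F^-1(X) is found only approximately: the penalised
  minimiser yields a nearby z, a nearby u in X and a multiplier v at u, where F z and u may differ.
  Hence the lower bound on the adjoint has to hold with z and u varying independently. It then keeps
  the multipliers bounded while the approximation is refined, so that a limiting multiplier at F x
  exists. The argument is asymmetric: for X an inclusion of limiting cones is needed, for Y the
  reverse one, and the latter holds pointwise for Frechet normals. As the lower bound rests on
  (a)-regularity, that condition is present in every case; strong (a) implies it because the cones
  are closed. The (b) conditions test only normals in the unit ball, so c v is tested in place of v,
  and 1/c enters the constants.\<close>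

lemma zero_in_frechet_normal_cone: "0 \<in> frechet_normal_cone Q x"
  by (auto simp: frechet_normal_cone_def)

lemma frechet_normal_cone_scaleR:
  assumes "v \<in> frechet_normal_cone Q x" "0 \<le> a"
  shows "a *\<^sub>R v \<in> frechet_normal_cone Q x"
proof (cases "a = 0")
  case True
  then show ?thesis by (simp add: zero_in_frechet_normal_cone)
next
  case False
  with assms have a: "a > 0" by simp
  show ?thesis
    unfolding frechet_normal_cone_def
  proof safe
    fix \<epsilon> :: real assume "\<epsilon> > 0"
    then have "\<epsilon> / a > 0" using a by simp
    then have "eventually (\<lambda>y. v \<bullet> (y - x) \<le> \<epsilon> / a * norm (y - x)) (at x within Q)"
      using assms(1) by (auto simp: frechet_normal_cone_def)
    then show "eventually (\<lambda>y. (a *\<^sub>R v) \<bullet> (y - x) \<le> \<epsilon> * norm (y - x)) (at x within Q)"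
      by eventually_elim (use a in \<open>simp add: field_simps\<close>)
  qed
qed

lemma frechet_normal_cone_Int_open:
  assumes "open U" "x \<in> U"
  shows "frechet_normal_cone (Q \<inter> U) x = frechet_normal_cone Q x"
proof -
  have "at x within (Q \<inter> U) = at x within Q"
    by (rule at_within_nhd[OF assms(2,1)]) auto
  then show ?thesis by (simp add: frechet_normal_cone_def)
qed

lemma frechet_subset_limiting:
  assumes "x \<in> Q"
  shows "frechet_normal_cone Q x \<subseteq> limiting_normal_cone Q x"
proof
  fix v assume "v \<in> frechet_normal_cone Q x"
  then have "(\<forall>i::nat. (\<lambda>_. x) i \<in> Q \<and> (\<lambda>_. v) i \<in> frechet_normal_cone Q ((\<lambda>_. x) i))
      \<and> (\<lambda>_::nat. x) \<longlonglongrightarrow> x \<and> (\<lambda>_::nat. v) \<longlonglongrightarrow> v"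
    using assms by simp
  then show "v \<in> limiting_normal_cone Q x"
    unfolding limiting_normal_cone_def by (intro CollectI exI)
qed

lemma limiting_normal_coneI:
  assumes "\<And>i::nat. xs i \<in> Q" "\<And>i. vs i \<in> frechet_normal_cone Q (xs i)"
    and "xs \<longlonglongrightarrow> x" "vs \<longlonglongrightarrow> v"
  shows "v \<in> limiting_normal_cone Q x"
  using assms unfolding limiting_normal_cone_def by blast

lemma limiting_normal_coneE:
  assumes "v \<in> limiting_normal_cone Q x"
  obtains xs vs where "\<And>i::nat. xs i \<in> Q" "\<And>i. vs i \<in> frechet_normal_cone Q (xs i)"
    "xs \<longlonglongrightarrow> x" "vs \<longlonglongrightarrow> v"
  using assms unfolding limiting_normal_cone_def by blast

lemma limiting_normal_cone_scaleR:
  assumes "v \<in> limiting_normal_cone Q x" "0 \<le> a"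
  shows "a *\<^sub>R v \<in> limiting_normal_cone Q x"
proof -
  obtain xs vs where *: "\<And>i::nat. xs i \<in> Q" "\<And>i. vs i \<in> frechet_normal_cone Q (xs i)"
    "xs \<longlonglongrightarrow> x" "vs \<longlonglongrightarrow> v"
    using limiting_normal_coneE[OF assms(1)] by blast
  show ?thesis
    by (rule limiting_normal_coneI[of xs _ "\<lambda>i. a *\<^sub>R vs i"])
      (use * assms(2) in \<open>auto intro!: frechet_normal_cone_scaleR tendsto_intros\<close>)
qed

text \<open>Only the tail of a sequence tending to \<open>x\<close> matters, and it lies in
  \<open>U\<close>. This allows \<open>holds_near\<close> to be treated with the normal cones of the
  full sets.\<close>

lemma limiting_normal_cone_Int_open:
  assumes "open U" "x \<in> U"
  shows "limiting_normal_cone (Q \<inter> U) x = limiting_normal_cone Q x"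
proof (intro equalityI subsetI)
  fix v assume "v \<in> limiting_normal_cone (Q \<inter> U) x"
  then obtain xs vs where *: "\<And>i::nat. xs i \<in> Q \<inter> U"
    "\<And>i. vs i \<in> frechet_normal_cone (Q \<inter> U) (xs i)" "xs \<longlonglongrightarrow> x" "vs \<longlonglongrightarrow> v"
    using limiting_normal_coneE by blast
  show "v \<in> limiting_normal_cone Q x"
    by (rule limiting_normal_coneI[of xs _ vs])
      (use * frechet_normal_cone_Int_open[OF assms(1)] in auto)
next
  fix v assume "v \<in> limiting_normal_cone Q x"
  then obtain xs vs where *: "\<And>i::nat. xs i \<in> Q"
    "\<And>i. vs i \<in> frechet_normal_cone Q (xs i)" "xs \<longlonglongrightarrow> x" "vs \<longlonglongrightarrow> v"
    using limiting_normal_coneE by blast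
  obtain N where N: "\<And>i. i \<ge> N \<Longrightarrow> xs i \<in> U"
    using topological_tendstoD[OF *(3) assms] by (auto simp: eventually_sequentially)
  show "v \<in> limiting_normal_cone (Q \<inter> U) x"
    by (rule limiting_normal_coneI[of "\<lambda>i. xs (i + N)" _ "\<lambda>i. vs (i + N)"])
      (use * N frechet_normal_cone_Int_open[OF assms(1)] LIMSEQ_ignore_initial_segment in auto)
qed

text \<open>Diagonal choice: each pair is replaced by a Frechet pair within 1/(i+1) in both
  components.\<close>

lemma limiting_normal_cone_closed_graph:
  assumes "\<And>i::nat. vs i \<in> limiting_normal_cone Q (xs i)" "xs \<longlonglongrightarrow> x" "vs \<longlonglongrightarrow> v"
  shows "v \<in> limiting_normal_cone Q x"
proof -
  have "\<exists>p. fst p \<in> Q \<and> snd p \<in> frechet_normal_cone Q (fst p) \<and>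
      dist (fst p) (xs i) < inverse (Suc i) \<and> dist (snd p) (vs i) < inverse (Suc i)" for i
  proof -
    obtain a b where *: "\<And>j::nat. a j \<in> Q" "\<And>j. b j \<in> frechet_normal_cone Q (a j)"
      "a \<longlonglongrightarrow> xs i" "b \<longlonglongrightarrow> vs i"
      using limiting_normal_coneE[OF assms(1)] by blast
    have "eventually (\<lambda>j. dist (a j) (xs i) < inverse (Suc i) \<and>
        dist (b j) (vs i) < inverse (Suc i)) sequentially"
      by (intro eventually_conj tendstoD *(3,4)) auto
    then obtain j where "dist (a j) (xs i) < inverse (Suc i)" "dist (b j) (vs i) < inverse (Suc i)"
      by (auto simp: eventually_sequentially)
    then show ?thesis using *(1,2) by (intro exI[of _ "(a j, b j)"]) auto
  qed
  then obtain p where p: "\<And>i. fst (p i) \<in> Q" "\<And>i. snd (p i) \<in> frechet_normal_cone Q (fst (p i))"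
    "\<And>i. dist (fst (p i)) (xs i) < inverse (Suc i)"
    "\<And>i. dist (snd (p i)) (vs i) < inverse (Suc i)"
    by metis
  have 1: "(\<lambda>i. fst (p i) - xs i) \<longlonglongrightarrow> 0" "(\<lambda>i. snd (p i) - vs i) \<longlonglongrightarrow> 0"
    using p(3,4)
    by (auto intro!: Lim_null_comparison[OF _ LIMSEQ_inverse_real_of_nat] always_eventually
        less_imp_le simp: dist_norm)
  have "(\<lambda>i. fst (p i)) \<longlonglongrightarrow> x" "(\<lambda>i. snd (p i)) \<longlonglongrightarrow> v"
    using tendsto_add[OF 1(1) assms(2)] tendsto_add[OF 1(2) assms(3)] by simp_all
  then show ?thesis
    using p by (intro limiting_normal_coneI[of "\<lambda>i. fst (p i)" _ "\<lambda>i. snd (p i)"]) auto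
qed

lemma closed_limiting_normal_cone: "closed (limiting_normal_cone Q x)"
  unfolding closed_sequential_limits
  using limiting_normal_cone_closed_graph[where xs = "\<lambda>_. x"] by fastforce

text \<open>The limiting cone is squeezed between the Frechet and the Clarke cone. A normal to a
  regular set can therefore be used as a first-order inequality at one point instead of a
  limit.\<close>

lemma limiting_eq_frechet_if_clarke_regular:
  assumes "clarke_regular Q" "x \<in> Q"
  shows "limiting_normal_cone Q x = frechet_normal_cone Q x"
proof
  show "frechet_normal_cone Q x \<subseteq> limiting_normal_cone Q x"
    using assms(2) by (rule frechet_subset_limiting)
  have "limiting_normal_cone Q x \<subseteq> clarke_normal_cone Q x"
    unfolding clarke_normal_cone_def by (meson closure_subset hull_subset order_trans)
  then show "limiting_normal_cone Q x \<subseteq> frechet_normal_cone Q x"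
    using assms by (simp add: clarke_regular_def clarke_regular_at_def)
qed

section \<open>Adjoints of bounded linear maps\<close>

lemma inner_adjoint_blinfun:
  fixes A :: "'w::euclidean_space \<Rightarrow>\<^sub>L 'e::euclidean_space"
  shows "adjoint (blinfun_apply A) v \<bullet> h = v \<bullet> A h"
  using adjoint_works[of "blinfun_apply A" h v] linear_linear[of "blinfun_apply A"]
    blinfun.bounded_linear_right[of A] bounded_linear.linear by (simp add: inner_commute)

lemma adjoint_blinfun_scaleR:
  fixes A :: "'w::euclidean_space \<Rightarrow>\<^sub>L 'e::euclidean_space"
  shows "adjoint (blinfun_apply A) (a *\<^sub>R v) = a *\<^sub>R adjoint (blinfun_apply A) v"
  by (rule vector_eq_rdot[THEN iffD1]) (simp add: inner_adjoint_blinfun)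

text \<open>Separates the change of the map from the change of the normal. In the strong (a)
  estimate a Lipschitz bound on \<open>F'\<close> controls the first summand and the hypothesis on
  the normals the second.\<close>

lemma adjoint_blinfun_diff:
  fixes A :: "'w::euclidean_space \<Rightarrow>\<^sub>L 'e::euclidean_space"
  shows "adjoint (blinfun_apply A) v - adjoint (blinfun_apply B) u =
    adjoint (blinfun_apply (A - B)) v + adjoint (blinfun_apply B) (v - u)"
  by (rule vector_eq_rdot[THEN iffD1])
    (simp add: inner_adjoint_blinfun inner_diff_left inner_add_left blinfun.diff_left
      inner_diff_right algebra_simps)

lemma norm_adjoint_blinfun_le:
  fixes A :: "'w::euclidean_space \<Rightarrow>\<^sub>L 'e::euclidean_space"
  shows "norm (adjoint (blinfun_apply A) v) \<le> norm A * norm v"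
proof -
  let ?a = "adjoint (blinfun_apply A) v"
  have "norm ?a * norm ?a = v \<bullet> A ?a"
    by (metis inner_adjoint_blinfun power2_norm_eq_inner power2_eq_square)
  also have "\<dots> \<le> norm v * (norm A * norm ?a)"
    by (meson norm_cauchy_schwarz norm_blinfun mult_left_mono norm_ge_zero order_trans)
  finally show ?thesis
    by (cases "?a = 0") (auto simp: mult_ac)
qed

text \<open>Tested against a basis vector \<open>b\<close>, the adjoint becomes
  \<open>v i \<bullet> A i b\<close>, which is jointly continuous in operator and vector.\<close>

lemma tendsto_adjoint_blinfun:
  fixes A :: "'i \<Rightarrow> 'w::euclidean_space \<Rightarrow>\<^sub>L 'e::euclidean_space"
  assumes "(A \<longlongrightarrow> B) G" "(v \<longlongrightarrow> u) G"
  shows "((\<lambda>i. adjoint (blinfun_apply (A i)) (v i)) \<longlongrightarrow> adjoint (blinfun_apply B) u) G"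
  by (subst tendsto_componentwise_iff)
    (auto simp: inner_adjoint_blinfun intro!: tendsto_intros assms)

section \<open>The chain rule for normal cones to preimages\<close>

text \<open>Were the gradient longer than \<open>\<epsilon>\<close>, a short step along
  \<open>- p\<close> would lower \<open>\<psi>\<close> by more than the slope term
  \<open>\<epsilon> * norm (y - z)\<close> compensates. This stands in for a subdifferential
  calculus of the norm.\<close>

lemma gradient_norm_le_of_local_min:
  fixes \<psi> :: "'w::euclidean_space \<Rightarrow> real"
  assumes der: "(\<psi> has_derivative (\<lambda>h. p \<bullet> h)) (at z)"
    and \<epsilon>: "\<epsilon> \<ge> 0"
    and min: "eventually (\<lambda>y. \<psi> z \<le> \<psi> y + \<epsilon> * norm (y - z)) (at z)"
  shows "norm p \<le> \<epsilon>"
proof (rule ccontr)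
  assume "\<not> norm p \<le> \<epsilon>"
  \<comment> \<open>Half of the gap is granted to the differentiability error, so
    \<open>e + \<epsilon>\<close> stays below \<open>norm p\<close>.\<close>
  define e where "e = (norm p - \<epsilon>) / 2"
  have e: "e > 0" and p: "norm p > \<epsilon>" "p \<noteq> 0"
    using \<open>\<not> norm p \<le> \<epsilon>\<close> \<epsilon> by (auto simp: e_def)
  obtain d1 where d1: "d1 > 0"
    "\<And>y. norm (y - z) < d1 \<Longrightarrow> norm (\<psi> y - \<psi> z - p \<bullet> (y - z)) \<le> e * norm (y - z)"
    using der e unfolding has_derivative_at_alt by blast
  obtain d2 where d2: "d2 > 0"
    "\<And>y. y \<noteq> z \<Longrightarrow> dist y z < d2 \<Longrightarrow> \<psi> z \<le> \<psi> y + \<epsilon> * norm (y - z)"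
    using min unfolding eventually_at by auto
  define t where "t = min d1 d2 / (2 * norm p)"
  have t: "t > 0" "t * norm p < d1" "t * norm p < d2"
    using d1(1) d2(1) p by (auto simp: t_def)
  define y where "y = z - t *\<^sub>R p"
  have n: "norm (y - z) = t * norm p" and ip: "p \<bullet> (y - z) = - t * (norm p)\<^sup>2"
    using t by (auto simp: y_def power2_norm_eq_inner)
  have "\<psi> z \<le> \<psi> y + \<epsilon> * norm (y - z)"
    by (rule d2(2)) (use t p n in \<open>auto simp: y_def dist_norm\<close>)
  moreover have "norm (\<psi> y - \<psi> z - p \<bullet> (y - z)) \<le> e * norm (y - z)"
    by (rule d1(2)) (use t n in auto)
  ultimately have "t * (norm p)\<^sup>2 \<le> (e + \<epsilon>) * (t * norm p)"
    unfolding n ip by (auto simp: algebra_simps abs_le_iff)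
  then have "(t * norm p) * norm p \<le> (t * norm p) * (e + \<epsilon>)"
    by (simp add: power2_eq_square mult_ac)
  then have "norm p \<le> e + \<epsilon>"
    using t p by (simp add: mult_le_cancel_left)
  then show False using p by (simp add: e_def field_simps)
qed

lemma proximal_in_frechet_normal_cone:
  assumes "\<delta> > 0" and "k \<ge> 0"
    and *: "\<And>y. y \<in> Q \<Longrightarrow> dist y x < \<delta> \<Longrightarrow> v \<bullet> (y - x) \<le> k * (norm (y - x))\<^sup>2"
  shows "v \<in> frechet_normal_cone Q x"
  unfolding frechet_normal_cone_def
proof safe
  fix \<epsilon> :: real assume \<epsilon>: "\<epsilon> > 0"
  show "eventually (\<lambda>y. v \<bullet> (y - x) \<le> \<epsilon> * norm (y - x)) (at x within Q)"
    unfolding eventually_at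
  \<comment> \<open>Within \<open>\<epsilon> / (k + 1)\<close> the quadratic bound drops below the
    linear one; the \<open>+ 1\<close> keeps the divisor positive when \<open>k = 0\<close>.\<close>
  proof (intro exI[of _ "min \<delta> (\<epsilon> / (k + 1))"] conjI ballI impI)
    show "min \<delta> (\<epsilon> / (k + 1)) > 0" using assms \<epsilon> by simp
    fix y assume y: "y \<in> Q" "y \<noteq> x \<and> dist y x < min \<delta> (\<epsilon> / (k + 1))"
    then have "norm (y - x) * (k + 1) \<le> \<epsilon>"
      using \<open>k \<ge> 0\<close> by (simp add: dist_norm field_simps)
    then have "k * norm (y - x) \<le> \<epsilon>"
      by (simp add: algebra_simps) (use norm_ge_zero[of "y - x"] in linarith)
    from mult_right_mono[OF this norm_ge_zero[of "y - x"]]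
    have "k * (norm (y - x))\<^sup>2 \<le> \<epsilon> * norm (y - x)"
      by (simp add: power2_eq_square mult.assoc)
    moreover have "v \<bullet> (y - x) \<le> k * (norm (y - x))\<^sup>2"
      using *[OF y(1)] y(2) by simp
    ultimately show "v \<bullet> (y - x) \<le> \<epsilon> * norm (y - x)"
      by linarith
  qed
qed

text \<open>Minimise \<open>-w \<bullet> (z - x) + \<epsilon> \<parallel>z - x\<parallel> + k \<parallel>F z - u\<parallel>\<^sup>2\<close> over \<open>z\<close> near \<open>x\<close> and \<open>u \<in> X\<close> near
  \<open>F x\<close>. For large \<open>k\<close> the minimiser is close to \<open>(x, F x)\<close>, and \<open>v = 2k (F z - u)\<close> is the
  multiplier.\<close>

lemma frechet_normal_preimage_approx:
  fixes F :: "'w::euclidean_space \<Rightarrow> 'e::euclidean_space"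
  assumes der: "\<And>x. (F has_derivative blinfun_apply (F' x)) (at x)"
    and lc: "locally_closed_at X (F x)" and FX: "F x \<in> X"
    and w: "w \<in> frechet_normal_cone (F -` X) x" and \<epsilon>: "\<epsilon> > 0"
  shows "\<exists>z u v. norm (z - x) < \<epsilon> \<and> u \<in> X \<and> norm (u - F x) < \<epsilon> \<and>
    v \<in> frechet_normal_cone X u \<and> norm (w - adjoint (blinfun_apply (F' z)) v) \<le> \<epsilon>"
proof -
  have contF: "continuous_on S F" for S
    using der has_derivative_continuous continuous_at_imp_continuous_on by blast
  \<comment> \<open>Only half of \<open>\<epsilon>\<close> is spent on the normal inequality while
    the objective carries all of it; the surplus later forces the limit of the minimisers onto
    \<open>x\<close>.\<close>
  have "\<epsilon> / 2 > 0" using \<epsilon> by simp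
  then have "eventually (\<lambda>y. w \<bullet> (y - x) \<le> \<epsilon> / 2 * norm (y - x)) (at x within F -` X)"
    using w unfolding frechet_normal_cone_def by blast
  then obtain r1 where r1: "r1 > 0" "\<And>y. F y \<in> X \<Longrightarrow> y \<noteq> x \<Longrightarrow> dist y x < r1 \<Longrightarrow>
      w \<bullet> (y - x) \<le> \<epsilon> / 2 * norm (y - x)"
    unfolding eventually_at by auto
  obtain r2 where r2: "r2 > 0" "closed (cball (F x) r2 \<inter> X)"
    using lc by (auto simp: locally_closed_at_def)
  define r where "r = min r1 \<epsilon> / 2"
  define s where "s = min r2 \<epsilon> / 2"
  have r: "r > 0" "r < r1" "r < \<epsilon>" and s: "s > 0" "s < r2" "s < \<epsilon>"
    using r1(1) r2(1) \<epsilon> by (auto simp: r_def s_def)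
  have "cball (F x) s \<inter> X = cball (F x) s \<inter> (cball (F x) r2 \<inter> X)"
    using s by auto
  then have cX: "compact (cball (F x) s \<inter> X)"
    using r2(2) compact_Int_closed[OF compact_cball] by metis
  define K where "K = cball x r \<times> (cball (F x) s \<inter> X)"
  have K: "compact K" "(x, F x) \<in> K"
    using cX FX r s by (auto simp: K_def intro!: compact_Times)
  define g where "g k q = - (w \<bullet> (fst q - x)) + \<epsilon> * norm (fst q - x)
      + real k * (norm (F (fst q) - snd q))\<^sup>2" for k q
  have "\<exists>q\<in>K. \<forall>q'\<in>K. g k q \<le> g k q'" for k
  proof (rule continuous_attains_inf)
    show "continuous_on K (g k)"
      unfolding g_def
      by (intro continuous_intros continuous_on_compose2[OF contF[of UNIV]]) auto
  qed (use K in auto)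
  then obtain q where q: "\<And>k. q k \<in> K" "\<And>k q'. q' \<in> K \<Longrightarrow> g k (q k) \<le> g k q'"
    by metis
  have g0: "g k (q k) \<le> 0" for k
    using q(2)[OF K(2), of k] by (simp add: g_def)
  have "seq_compact K" using K(1) by (simp add: compact_eq_seq_compact_metric)
  then obtain l \<sigma> where l: "l \<in> K" "strict_mono \<sigma>" "(q \<circ> \<sigma>) \<longlonglongrightarrow> l"
    using q(1) unfolding seq_compact_def by metis
  have lim1: "(\<lambda>i. fst (q (\<sigma> i))) \<longlonglongrightarrow> fst l" "(\<lambda>i. snd (q (\<sigma> i))) \<longlonglongrightarrow> snd l"
    using tendsto_fst[OF l(3)] tendsto_snd[OF l(3)] by (simp_all add: o_def)
  have limF: "(\<lambda>i. F (fst (q (\<sigma> i)))) \<longlonglongrightarrow> F (fst l)"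
    by (rule isCont_tendsto_compose[OF _ lim1(1)]) (use der has_derivative_continuous in blast)
  \<comment> \<open>The competitor \<open>(x, F x)\<close> has value 0, so the penalty term has a
    bound free of the index; division by \<open>\<sigma> i\<close> then sends \<open>F z - u\<close>
    to 0.\<close>
  have "real (\<sigma> i) * (norm (F (fst (q (\<sigma> i))) - snd (q (\<sigma> i))))\<^sup>2 \<le> norm w * r" for i
  proof -
    have "w \<bullet> (fst (q (\<sigma> i)) - x) \<le> norm w * norm (fst (q (\<sigma> i)) - x)"
      by (rule norm_cauchy_schwarz)
    also have "\<dots> \<le> norm w * r"
      using q(1)[of "\<sigma> i"]
      by (intro mult_left_mono) (auto simp: K_def mem_Times_iff dist_norm norm_minus_commute)
    finally have "w \<bullet> (fst (q (\<sigma> i)) - x) \<le> norm w * r" .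
    moreover have "0 \<le> \<epsilon> * norm (fst (q (\<sigma> i)) - x)" using \<epsilon> by simp
    ultimately show ?thesis
      using g0[of "\<sigma> i"] unfolding g_def by linarith
  qed
  then have bd: "(norm (F (fst (q (\<sigma> i))) - snd (q (\<sigma> i))))\<^sup>2 \<le> norm w * r / real (\<sigma> i)"
    if "\<sigma> i > 0" for i
    using that by (simp add: field_simps)
  have "(\<lambda>i. norm w * r / real (\<sigma> i)) \<longlonglongrightarrow> 0"
    by (intro tendsto_divide_0[OF tendsto_const] filterlim_at_top_imp_at_infinity
        filterlim_compose[OF filterlim_real_sequentially] filterlim_subseq l(2))
  moreover have "eventually (\<lambda>i. \<sigma> i > 0) sequentially"
    using filterlim_subseq[OF l(2)] eventually_gt_at_top[of 0] by (rule eventually_compose_filterlim[rotated])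
  ultimately have "(\<lambda>i. (norm (F (fst (q (\<sigma> i))) - snd (q (\<sigma> i))))\<^sup>2) \<longlonglongrightarrow> 0"
    by (elim Lim_null_comparison[rotated]) (auto elim!: eventually_mono dest: bd)
  moreover have "(\<lambda>i. (norm (F (fst (q (\<sigma> i))) - snd (q (\<sigma> i))))\<^sup>2) \<longlonglongrightarrow>
      (norm (F (fst l) - snd l))\<^sup>2"
    by (intro tendsto_intros limF lim1)
  ultimately have "(norm (F (fst l) - snd l))\<^sup>2 = 0"
    using LIMSEQ_unique by blast
  then have Fl: "F (fst l) = snd l" by simp
  have "(\<lambda>i. - (w \<bullet> (fst (q (\<sigma> i)) - x)) + \<epsilon> * norm (fst (q (\<sigma> i)) - x)) \<longlonglongrightarrow>
      - (w \<bullet> (fst l - x)) + \<epsilon> * norm (fst l - x)"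
    by (intro tendsto_intros lim1)
  moreover have "- (w \<bullet> (fst (q (\<sigma> i)) - x)) + \<epsilon> * norm (fst (q (\<sigma> i)) - x) \<le> 0" for i
    using g0[of "\<sigma> i"] zero_le_power2[of "norm (F (fst (q (\<sigma> i))) - snd (q (\<sigma> i)))"]
      mult_nonneg_nonneg[of "real (\<sigma> i)"] unfolding g_def by (smt (verit) of_nat_0_le_iff)
  ultimately have "- (w \<bullet> (fst l - x)) + \<epsilon> * norm (fst l - x) \<le> 0"
    by (intro LIMSEQ_le_const2) auto
  \<comment> \<open>The limit point satisfies the constraint, so the normal inequality applies to
    it; with the nonpositive limit value this leaves
    \<open>\<epsilon> / 2 * norm (fst l - x) \<le> 0\<close>.\<close>
  moreover have "w \<bullet> (fst l - x) \<le> \<epsilon> / 2 * norm (fst l - x)"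
    using l(1) Fl r r1(2)[of "fst l"]
    by (cases "fst l = x") (auto simp: K_def mem_Times_iff dist_commute)
  ultimately have "\<epsilon> * norm (fst l - x) \<le> 0" by simp
  then have fl: "fst l = x"
    using \<epsilon> by (metis mult_le_0_iff norm_le_zero_iff not_less eq_iff_diff_eq_0)
  \<comment> \<open>Far along the subsequence the minimiser is strictly inside both balls, so the
    ball constraints are inactive and each coordinate can be varied on its own.\<close>
  have "eventually (\<lambda>i. dist (fst (q (\<sigma> i))) x < r \<and> dist (snd (q (\<sigma> i))) (F x) < s) sequentially"
    using lim1 fl Fl r s by (intro eventually_conj tendstoD) auto
  then obtain i where i: "dist (fst (q (\<sigma> i))) x < r" "dist (snd (q (\<sigma> i))) (F x) < s"
    by (auto simp: eventually_sequentially)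
  define k z u where "k = \<sigma> i" and "z = fst (q k)" and "u = snd (q k)"
  have z: "dist z x < r" and u: "dist u (F x) < s" "u \<in> X"
    using i q(1)[of k] by (auto simp: k_def z_def u_def K_def mem_Times_iff)
  have opt: "g k (z, u) \<le> g k (z', u')" if "dist z' x \<le> r" "dist u' (F x) \<le> s" "u' \<in> X" for z' u'
    using q(2)[of "(z', u')" k] that by (simp add: K_def z_def u_def dist_commute)
  define v where "v = (2 * real k) *\<^sub>R (F z - u)"
  \<comment> \<open>With \<open>z\<close> frozen, \<open>u\<close> minimises the weighted squared
    distance to \<open>F z\<close> over nearby points of \<open>X\<close>; expanding the square
    gives a proximal inequality for \<open>v\<close>.\<close>
  have "v \<in> frechet_normal_cone X u"
  proof (rule proximal_in_frechet_normal_cone)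
    show "s - dist u (F x) > 0" "real k \<ge> 0" using u by auto
    fix y assume y: "y \<in> X" "dist y u < s - dist u (F x)"
    then have "dist y (F x) \<le> s"
      using dist_triangle[of y "F x" u] by linarith
    then have "g k (z, u) \<le> g k (z, y)"
      using opt[of z y] z y by auto
    then have "real k * (norm (F z - u))\<^sup>2 \<le> real k * (norm (F z - y))\<^sup>2"
      by (simp add: g_def)
    moreover have "(norm (F z - y))\<^sup>2 =
        (norm (F z - u))\<^sup>2 - 2 * ((F z - u) \<bullet> (y - u)) + (norm (y - u))\<^sup>2"
      unfolding power2_norm_eq_inner by (simp add: inner_simps inner_commute algebra_simps)
    ultimately show "v \<bullet> (y - u) \<le> real k * (norm (y - u))\<^sup>2"
      by (simp add: v_def algebra_simps)
  qed
  \<comment> \<open>With \<open>u\<close> frozen, \<open>z\<close> minimises a smooth function plus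
    a norm term. The factor \<open>2 * real k\<close> in \<open>v\<close> comes from differentiating
    the square, and the triangle inequality recentres the norm term from \<open>x\<close> to
    \<open>z\<close>.\<close>
  moreover have "norm (- w + adjoint (blinfun_apply (F' z)) v) \<le> \<epsilon>"
  proof (rule gradient_norm_le_of_local_min)
    have "((\<lambda>y. - (w \<bullet> (y - x)) + real k * ((F y - u) \<bullet> (F y - u)))
        has_derivative (\<lambda>h. - (w \<bullet> h) + v \<bullet> F' z h)) (at z)"
      by (rule derivative_eq_intros der refl)+
        (auto simp: v_def inner_simps inner_commute algebra_simps)
    then show "((\<lambda>y. - (w \<bullet> (y - x)) + real k * ((F y - u) \<bullet> (F y - u)))
        has_derivative (\<lambda>h. (- w + adjoint (blinfun_apply (F' z)) v) \<bullet> h)) (at z)"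
      by (simp add: inner_diff_left inner_add_left inner_adjoint_blinfun)
    have "eventually (\<lambda>y. dist y z < r - dist z x) (at z)"
      using z unfolding eventually_at by (intro exI[of _ "r - dist z x"]) auto
    then show "eventually (\<lambda>y. - (w \<bullet> (z - x)) + real k * ((F z - u) \<bullet> (F z - u)) \<le>
        - (w \<bullet> (y - x)) + real k * ((F y - u) \<bullet> (F y - u)) + \<epsilon> * norm (y - z)) (at z)"
    proof eventually_elim
      case (elim y)
      then have "dist y x \<le> r"
        using dist_triangle[of y x z] by linarith
      then have "g k (z, u) \<le> g k (y, u)"
        using opt[of y u] u by auto
      moreover have "\<epsilon> * norm (y - x) \<le> \<epsilon> * norm (z - x) + \<epsilon> * norm (y - z)"
        using norm_triangle_ineq[of "z - x" "y - z"] \<epsilon>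
        by (simp flip: distrib_left)
      ultimately show ?case
        by (simp add: g_def power2_norm_eq_inner)
    qed
  qed (use \<epsilon> in simp)
  then have "norm (w - adjoint (blinfun_apply (F' z)) v) \<le> \<epsilon>"
    by (simp add: norm_minus_commute)
  ultimately show ?thesis
    using z u r s by (intro exI[of _ z] exI[of _ u] exI[of _ v]) (auto simp: dist_norm)
qed

text \<open>\<open>qual\<close> is asked on independent neighbourhoods of \<open>x\<close> and
  \<open>F x\<close> because approximate multipliers sit at points \<open>u\<close> that need not
  equal \<open>F z\<close>. It turns convergence of the adjoint images into boundedness of the
  multipliers, and a subsequence of these converges to the required \<open>v\<close>.\<close>

lemma limiting_normal_preimage:
  fixes F :: "'w::euclidean_space \<Rightarrow> 'e::euclidean_space"
  assumes der: "\<And>x. (F has_derivative blinfun_apply (F' x)) (at x)"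
    and cont: "isCont F' x"
    and lc: "locally closed X"
    and c: "c > 0" and \<delta>: "\<delta> > 0"
    and qual: "\<And>z u v. z \<in> ball x \<delta> \<Longrightarrow> u \<in> X \<inter> ball (F x) \<delta> \<Longrightarrow> v \<in> limiting_normal_cone X u \<Longrightarrow>
      c * norm v \<le> norm (adjoint (blinfun_apply (F' z)) v)"
    and w: "w \<in> limiting_normal_cone (F -` X) x"
  shows "\<exists>v\<in>limiting_normal_cone X (F x). w = adjoint (blinfun_apply (F' x)) v"
proof -
  obtain xs ws where xs: "\<And>i::nat. F (xs i) \<in> X" "\<And>i. ws i \<in> frechet_normal_cone (F -` X) (xs i)"
    "xs \<longlonglongrightarrow> x" "ws \<longlonglongrightarrow> w"
    using limiting_normal_coneE[OF w] by (metis vimage_eq)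
  have "\<exists>z u v. norm (z - xs i) < inverse (Suc i) \<and> u \<in> X \<and> norm (u - F (xs i)) < inverse (Suc i) \<and>
    v \<in> frechet_normal_cone X u \<and> norm (ws i - adjoint (blinfun_apply (F' z)) v) \<le> inverse (Suc i)" for i
    using lc xs by (intro frechet_normal_preimage_approx der) (auto simp: locally_closed_iff)
  then obtain z u v where *: "\<And>i. norm (z i - xs i) < inverse (Suc i)" "\<And>i. u i \<in> X"
    "\<And>i. norm (u i - F (xs i)) < inverse (Suc i)" "\<And>i. v i \<in> frechet_normal_cone X (u i)"
    "\<And>i. norm (ws i - adjoint (blinfun_apply (F' (z i))) (v i)) \<le> inverse (Suc i)"
    by metis
  have "isCont F x" using der has_derivative_continuous by blast
  then have Fxs: "(\<lambda>i. F (xs i)) \<longlonglongrightarrow> F x"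
    using xs(3) by (rule isCont_tendsto_compose)
  have "(\<lambda>i. z i - xs i) \<longlonglongrightarrow> 0" "(\<lambda>i. u i - F (xs i)) \<longlonglongrightarrow> 0"
    "(\<lambda>i. ws i - adjoint (blinfun_apply (F' (z i))) (v i)) \<longlonglongrightarrow> 0"
    using less_imp_le[OF *(1)] less_imp_le[OF *(3)] *(5)
    by (auto intro!: Lim_null_comparison[OF _ LIMSEQ_inverse_real_of_nat] always_eventually)
  from tendsto_add[OF this(1) xs(3)] tendsto_add[OF this(2) Fxs] tendsto_diff[OF xs(4) this(3)]
  have lim: "z \<longlonglongrightarrow> x" "u \<longlonglongrightarrow> F x" "(\<lambda>i. adjoint (blinfun_apply (F' (z i))) (v i)) \<longlonglongrightarrow> w"
    by simp_all
  have "eventually (\<lambda>i. z i \<in> ball x \<delta> \<and> u i \<in> ball (F x) \<delta>) sequentially"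
    using lim \<delta> by (intro eventually_conj topological_tendstoD) auto
  moreover have "v i \<in> limiting_normal_cone X (u i)" for i
    using *(2,4) frechet_subset_limiting by blast
  ultimately have ev: "eventually (\<lambda>i. c * norm (v i) \<le> norm (adjoint (blinfun_apply (F' (z i))) (v i))) sequentially"
    by (auto elim!: eventually_mono intro!: qual simp: *(2))
  have "Bseq (\<lambda>i. adjoint (blinfun_apply (F' (z i))) (v i))"
    using lim(3) by (intro convergent_imp_Bseq convergentI)
  then obtain M where M: "M > 0" "\<And>i. norm (adjoint (blinfun_apply (F' (z i))) (v i)) \<le> M"
    by (auto simp: Bseq_def)
  have "eventually (\<lambda>i. norm (v i) \<le> M / c) sequentially"
    using ev by eventually_elim (use M c order_trans in \<open>fastforce simp: field_simps\<close>)
  then have "Bseq v"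
    by (rule BfunI)
  then have "bounded (range v)" by (simp add: Bseq_eq_bounded)
  then obtain v0 \<sigma> where \<sigma>: "strict_mono \<sigma>" "(v \<circ> \<sigma>) \<longlonglongrightarrow> v0"
    using bounded_imp_convergent_subsequence by blast
  have lim\<sigma>: "(z \<circ> \<sigma>) \<longlonglongrightarrow> x" "(u \<circ> \<sigma>) \<longlonglongrightarrow> F x"
    "((\<lambda>i. adjoint (blinfun_apply (F' (z i))) (v i)) \<circ> \<sigma>) \<longlonglongrightarrow> w"
    using lim LIMSEQ_subseq_LIMSEQ[OF _ \<sigma>(1)] by blast+
  have "v0 \<in> limiting_normal_cone X (F x)"
    by (rule limiting_normal_coneI[OF _ _ lim\<sigma>(2) \<sigma>(2)]) (use * in auto)
  moreover have "(\<lambda>i. adjoint (blinfun_apply (F' ((z \<circ> \<sigma>) i))) ((v \<circ> \<sigma>) i)) \<longlonglongrightarrow>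
      adjoint (blinfun_apply (F' x)) v0"
    by (intro tendsto_adjoint_blinfun isCont_tendsto_compose[OF cont] lim\<sigma> \<sigma>)
  then have "w = adjoint (blinfun_apply (F' x)) v0"
    using lim\<sigma>(3) by (intro LIMSEQ_unique[of _ w]) (auto simp: o_def)
  ultimately show ?thesis by blast
qed

lemma adjoint_frechet_normal_preimage:
  fixes F :: "'w::euclidean_space \<Rightarrow> 'e::euclidean_space"
  assumes der: "(F has_derivative blinfun_apply A) (at y)"
    and v: "v \<in> frechet_normal_cone Q (F y)"
  shows "adjoint (blinfun_apply A) v \<in> frechet_normal_cone (F -` Q) y"
  unfolding frechet_normal_cone_def
proof safe
  fix \<epsilon> :: real assume \<epsilon>: "\<epsilon> > 0"
  \<comment> \<open>Both errors are multiples of \<open>e * norm (x - y)\<close>: the factor is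
    \<open>norm A + 1\<close> for the growth of \<open>F\<close> and \<open>norm v\<close> for the
    linearisation remainder. This \<open>e\<close> makes the total
    \<open>\<epsilon>\<close>.\<close>
  define e where "e = \<epsilon> / (norm A + 1 + norm v)"
  have e: "e > 0" using \<epsilon> by (simp add: e_def add_nonneg_pos add_pos_nonneg)
  obtain \<delta> where \<delta>: "\<delta> > 0"
    "\<And>q. q \<in> Q \<Longrightarrow> q \<noteq> F y \<Longrightarrow> dist q (F y) < \<delta> \<Longrightarrow> v \<bullet> (q - F y) \<le> e * norm (q - F y)"
    using v e unfolding frechet_normal_cone_def eventually_at by auto
  have "isCont F y" using der by (rule has_derivative_continuous)
  then have "eventually (\<lambda>x. dist (F x) (F y) < \<delta>) (at y)"
    using \<delta>(1) by (simp add: isCont_def tendstoD)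
  \<comment> \<open>The bound 1 on the remainder rate gives the growth rate
    \<open>norm A + 1\<close>; the bound \<open>e\<close> makes the remainder small.\<close>
  moreover have "min 1 e > 0" using e by simp
  then have "\<exists>d>0. \<forall>x. norm (x - y) < d \<longrightarrow> norm (F x - F y - A (x - y)) \<le> min 1 e * norm (x - y)"
    using der unfolding has_derivative_at_alt by blast
  then have "eventually (\<lambda>x. norm (F x - F y - A (x - y)) \<le> min 1 e * norm (x - y)) (at y)"
    unfolding eventually_at by (auto simp: dist_norm)
  ultimately have "eventually (\<lambda>x. F x \<in> Q \<longrightarrow>
      adjoint (blinfun_apply A) v \<bullet> (x - y) \<le> \<epsilon> * norm (x - y)) (at y)"
  proof eventually_elim
    case (elim x)
    show ?case
    proof
      assume "F x \<in> Q"
      let ?r = "F x - F y - A (x - y)" and ?t = "norm (x - y)"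
      have 1: "norm ?r \<le> ?t" "norm ?r \<le> e * ?t"
        using elim(2) mult_right_mono[of "min 1 e" 1 ?t] mult_right_mono[of "min 1 e" e ?t] by auto
      have "norm (F x - F y) \<le> norm (A (x - y)) + norm ?r"
        using norm_triangle_ineq[of "A (x - y)" ?r] by simp
      also have "\<dots> \<le> (norm A + 1) * ?t"
        using norm_blinfun[of A "x - y"] 1 by (simp add: algebra_simps)
      finally have "e * norm (F x - F y) \<le> e * ((norm A + 1) * ?t)"
        using e by simp
      moreover have "v \<bullet> (F x - F y) \<le> e * norm (F x - F y)"
        using \<delta>(2)[OF \<open>F x \<in> Q\<close>] elim(1) by (cases "F x = F y") auto
      moreover have "- (v \<bullet> ?r) \<le> norm v * (e * ?t)"
        using norm_cauchy_schwarz[of "- v" ?r] 1(2) mult_left_mono[OF 1(2), of "norm v"] by simp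
      ultimately have "v \<bullet> A (x - y) \<le> e * ((norm A + 1) * ?t) + norm v * (e * ?t)"
        by (simp add: inner_diff_right)
      also have "\<dots> = e * (norm A + 1 + norm v) * ?t"
        by (simp add: algebra_simps)
      also have "e * (norm A + 1 + norm v) = \<epsilon>"
        using add_nonneg_pos[of "norm A + norm v" 1] by (simp add: e_def add_ac)
      finally show "adjoint (blinfun_apply A) v \<bullet> (x - y) \<le> \<epsilon> * ?t"
        by (simp add: inner_adjoint_blinfun)
    qed
  qed
  then show "eventually (\<lambda>x. adjoint (blinfun_apply A) v \<bullet> (x - y) \<le> \<epsilon> * norm (x - y))
      (at y within F -` Q)"
    by (auto simp: eventually_at_filter elim: eventually_mono)
qed

section \<open>Reformulations of the regularity conditions\<close>

text \<open>A limit point of \<open>vs\<close> is a limit along a subsequence, and the base points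
  still converge along it, so plain limits suffice.\<close>

lemma a_regular_Int_open_iff:
  assumes "open U"
  shows "a_regular (X \<inter> U) (Y \<inter> U) \<longleftrightarrow>
    (\<forall>xs vs y v. (\<forall>i::nat. xs i \<in> X \<inter> U \<and> vs i \<in> limiting_normal_cone X (xs i)) \<and>
      y \<in> Y \<inter> U \<and> xs \<longlonglongrightarrow> y \<and> vs \<longlonglongrightarrow> v \<longrightarrow> v \<in> limiting_normal_cone Y y)"
    (is "?l \<longleftrightarrow> ?r")
proof
  assume l: ?l
  show ?r
  proof safe
    fix xs :: "nat \<Rightarrow> 'a" and vs y v
    assume *: "\<forall>i. xs i \<in> X \<inter> U \<and> vs i \<in> limiting_normal_cone X (xs i)"
      "y \<in> Y" "y \<in> U" "xs \<longlonglongrightarrow> y" "vs \<longlonglongrightarrow> v"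
    have "\<forall>i. xs i \<in> X \<inter> U \<and> vs i \<in> limiting_normal_cone (X \<inter> U) (xs i)"
      using * limiting_normal_cone_Int_open[OF assms] by auto
    moreover have "strict_mono (id :: nat \<Rightarrow> nat)" "(vs \<circ> id) \<longlonglongrightarrow> v"
      using * by (auto simp: strict_mono_def)
    ultimately have "v \<in> limiting_normal_cone (Y \<inter> U) y"
      using l * unfolding a_regular_def by blast
    then show "v \<in> limiting_normal_cone Y y"
      using * limiting_normal_cone_Int_open[OF assms] by auto
  qed
next
  assume r: ?r
  show ?l
    unfolding a_regular_def
  proof safe
    fix xs :: "nat \<Rightarrow> 'a" and vs y v and \<sigma> :: "nat \<Rightarrow> nat"
    assume *: "\<forall>i. xs i \<in> X \<inter> U \<and> vs i \<in> limiting_normal_cone (X \<inter> U) (xs i)"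
      "y \<in> Y" "y \<in> U" "xs \<longlonglongrightarrow> y" "strict_mono \<sigma>" "(vs \<circ> \<sigma>) \<longlonglongrightarrow> v"
    have "\<forall>i. (xs \<circ> \<sigma>) i \<in> X \<inter> U \<and> (vs \<circ> \<sigma>) i \<in> limiting_normal_cone X ((xs \<circ> \<sigma>) i)"
      using * limiting_normal_cone_Int_open[OF assms] by auto
    moreover have "(xs \<circ> \<sigma>) \<longlonglongrightarrow> y"
      using * LIMSEQ_subseq_LIMSEQ by blast
    ultimately have "v \<in> limiting_normal_cone Y y"
      using r * by blast
    then show "v \<in> limiting_normal_cone (Y \<inter> U) y"
      using * limiting_normal_cone_Int_open[OF assms] by auto
  qed
qed

text \<open>\<open>0 \<in> V\<close> bounds the distance of unit vectors to \<open>V\<close> by 1,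
  so the real supremum is a genuine one; \<open>0 \<le> B\<close> settles the case in which the gap
  is 0 by convention.\<close>

lemma cone_gap_le_iff:
  assumes "0 \<in> V" "0 \<le> B"
  shows "cone_gap U V \<le> B \<longleftrightarrow> (\<forall>u\<in>U \<inter> sphere 0 1. infdist u V \<le> B)"
proof (cases "U \<inter> sphere 0 1 = {}")
  case True
  then show ?thesis using assms by (simp add: cone_gap_def)
next
  case False
  have "infdist u V \<le> 1" if "u \<in> U \<inter> sphere 0 1" for u
    using infdist_le[OF assms(1), of u] that by (simp add: dist_commute)
  then have "bdd_above ((\<lambda>u. infdist u V) ` (U \<inter> sphere 0 1))"
    by (intro bdd_aboveI2[of _ _ 1])
  then show ?thesis
    using False by (simp add: cone_gap_def cSUP_le_iff)
qed

text \<open>Both cones are stable under nonnegative scaling, so a bound on unit vectors is a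
  relative bound on all \<open>u\<close>. Closedness of the cone at \<open>y\<close> lets a nearest
  \<open>v\<close> replace the distance.\<close>

lemma strongly_a_regular_Int_open_iff:
  assumes "open U"
  shows "strongly_a_regular (X \<inter> U) (Y \<inter> U) \<longleftrightarrow>
    (\<exists>C>0. \<forall>x\<in>X \<inter> U. \<forall>y\<in>Y \<inter> U. \<forall>u\<in>limiting_normal_cone X x.
      \<exists>v\<in>limiting_normal_cone Y y. norm (u - v) \<le> C * norm (x - y) * norm u)"
proof -
  have "cone_gap (limiting_normal_cone (X \<inter> U) x) (limiting_normal_cone (Y \<inter> U) y)
        \<le> C * norm (x - y) \<longleftrightarrow>
      (\<forall>u\<in>limiting_normal_cone X x. \<exists>v\<in>limiting_normal_cone Y y.
        norm (u - v) \<le> C * norm (x - y) * norm u)" (is "?l \<longleftrightarrow> ?r")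
    if C: "C > 0" and x: "x \<in> X \<inter> U" and y: "y \<in> Y \<inter> U" for C x y
  proof -
    let ?N = "limiting_normal_cone X x" and ?M = "limiting_normal_cone Y y"
    have 0: "0 \<in> ?M"
      using frechet_subset_limiting zero_in_frechet_normal_cone y by blast
    have "?l \<longleftrightarrow> (\<forall>u\<in>?N \<inter> sphere 0 1. infdist u ?M \<le> C * norm (x - y))"
      using limiting_normal_cone_Int_open[OF assms] x y C 0 by (simp add: cone_gap_le_iff)
    also have "\<dots> \<longleftrightarrow> ?r"
    proof
      assume l: "\<forall>u\<in>?N \<inter> sphere 0 1. infdist u ?M \<le> C * norm (x - y)"
      show ?r
      proof
        fix u assume u: "u \<in> ?N"
        show "\<exists>v\<in>?M. norm (u - v) \<le> C * norm (x - y) * norm u"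
        proof (cases "u = 0")
          case True
          then show ?thesis using 0 by (intro bexI[of _ 0]) auto
        next
          case False
          let ?e = "u /\<^sub>R norm u"
          have "?e \<in> ?N \<inter> sphere 0 1"
            using u False by (auto intro: limiting_normal_cone_scaleR)
          moreover obtain v where v: "v \<in> ?M" "infdist ?e ?M = dist ?e v"
            using infdist_attains_inf[OF closed_limiting_normal_cone] 0 by blast
          ultimately have "norm (?e - v) \<le> C * norm (x - y)"
            using l by (metis dist_norm)
          then have "norm u * norm (?e - v) \<le> norm u * (C * norm (x - y))"
            by (intro mult_left_mono) auto
          moreover have "norm u * norm (?e - v) = norm (norm u *\<^sub>R (?e - v))"
            by simp
          then have "norm u * norm (?e - v) = norm (u - norm u *\<^sub>R v)"
            using False by (simp add: scaleR_diff_right)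
          ultimately show ?thesis
            using v(1) by (intro bexI[of _ "norm u *\<^sub>R v"])
              (auto intro: limiting_normal_cone_scaleR simp: mult_ac)
        qed
      qed
    next
      assume r: ?r
      show "\<forall>u\<in>?N \<inter> sphere 0 1. infdist u ?M \<le> C * norm (x - y)"
      proof
        fix u assume "u \<in> ?N \<inter> sphere 0 1"
        with r obtain v where "v \<in> ?M" "norm (u - v) \<le> C * norm (x - y)"
          by fastforce
        then show "infdist u ?M \<le> C * norm (x - y)"
          using infdist_le[of v ?M u] by (simp add: dist_norm)
      qed
    qed
    finally show ?thesis .
  qed
  then show ?thesis
    unfolding strongly_a_regular_def by (intro ex_cong conj_cong ball_cong refl) auto
qed

text \<open>Strong (a) supplies normals at the fixed point \<open>y\<close> whose distance to
  \<open>vs i\<close> tends to 0, and the cone at \<open>y\<close> is closed.\<close>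

lemma strongly_a_regular_imp_a_regular:
  assumes "open U" "strongly_a_regular (X \<inter> U) (Y \<inter> U)"
  shows "a_regular (X \<inter> U) (Y \<inter> U)"
  unfolding a_regular_Int_open_iff[OF assms(1)]
proof safe
  fix xs :: "nat \<Rightarrow> 'a" and vs y v
  assume *: "\<forall>i. xs i \<in> X \<inter> U \<and> vs i \<in> limiting_normal_cone X (xs i)"
    "y \<in> Y" "y \<in> U" "xs \<longlonglongrightarrow> y" "vs \<longlonglongrightarrow> v"
  obtain C where C: "\<And>x u. x \<in> X \<inter> U \<Longrightarrow> u \<in> limiting_normal_cone X x \<Longrightarrow>
      \<exists>v\<in>limiting_normal_cone Y y. norm (u - v) \<le> C * norm (x - y) * norm u"
    using assms(2) * unfolding strongly_a_regular_Int_open_iff[OF assms(1)] by blast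
  then have "\<forall>i. \<exists>v\<in>limiting_normal_cone Y y.
      norm (vs i - v) \<le> C * norm (xs i - y) * norm (vs i)"
    using * by blast
  then obtain us where us: "\<And>i. us i \<in> limiting_normal_cone Y y"
    "\<And>i. norm (vs i - us i) \<le> C * norm (xs i - y) * norm (vs i)"
    by metis
  have "(\<lambda>i. C * norm (xs i - y) * norm (vs i)) \<longlonglongrightarrow> C * norm (y - y) * norm v"
    by (intro tendsto_intros *)
  then have 0: "(\<lambda>i. C * norm (xs i - y) * norm (vs i)) \<longlonglongrightarrow> 0" by simp
  have "(\<lambda>i. vs i - us i) \<longlonglongrightarrow> 0"
    by (rule Lim_null_comparison[OF always_eventually 0]) (use us(2) in blast)
  from tendsto_diff[OF *(5) this] have lim: "us \<longlonglongrightarrow> v" by simp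
  show "v \<in> limiting_normal_cone Y y"
    by (rule limiting_normal_cone_closed_graph[OF us(1) tendsto_const lim])
qed

text \<open>\<open>b_part d s\<close> is the quantity bounded from above in \<open>b_bound d s\<close>; it is sublinear in \<open>s\<close>.\<close>

definition b_part :: "b_symbol \<Rightarrow> real \<Rightarrow> real" where
  "b_part d s = (case d of Le \<Rightarrow> s | Eq \<Rightarrow> \<bar>s\<bar> | Ge \<Rightarrow> - s)"

lemma b_bound_iff: "b_bound d s e \<longleftrightarrow> b_part d s \<le> e"
  by (cases d) (auto simp: b_part_def)

lemma b_part_le_abs: "b_part d s \<le> \<bar>s\<bar>"
  by (cases d) (auto simp: b_part_def)

lemma b_part_0 [simp]: "b_part d 0 = 0"
  by (cases d) (auto simp: b_part_def)

lemma b_part_mult: "0 \<le> a \<Longrightarrow> b_part d (a * s) = a * b_part d s"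
  by (cases d) (auto simp: b_part_def abs_mult)

lemma b_part_add_le: "b_part d (s + t) \<le> b_part d s + \<bar>t\<bar>"
  by (cases d) (auto simp: b_part_def)

text \<open>For the converse, \<open>err t\<close> is the least nonnegative error that works at
  distance \<open>t\<close>, a supremum over all triples. Uniformity of \<open>\<delta>\<close> in
  \<open>x\<close>, \<open>y\<close> and \<open>v\<close> makes it \<open>o(t)\<close>.\<close>

lemma b_regular_iff:
  "b_regular d X Y \<longleftrightarrow> (\<forall>\<epsilon>>0. \<exists>\<delta>>0. \<forall>x\<in>X. \<forall>y\<in>Y. \<forall>v\<in>limiting_normal_cone X x \<inter> cball 0 1.
    norm (y - x) < \<delta> \<longrightarrow> b_bound d (v \<bullet> (y - x)) (\<epsilon> * norm (y - x)))" (is "?l \<longleftrightarrow> ?r")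
proof
  assume ?l
  then obtain err where err: "((\<lambda>t. err t / t) \<longlongrightarrow> 0) (at_right 0)"
    "\<And>x y v. x \<in> X \<Longrightarrow> y \<in> Y \<Longrightarrow> v \<in> limiting_normal_cone X x \<inter> cball 0 1 \<Longrightarrow>
      b_bound d (v \<bullet> (y - x)) (err (norm (y - x)))"
    unfolding b_regular_def by blast
  show ?r
  proof (intro allI impI)
    fix \<epsilon> :: real assume "\<epsilon> > 0"
    then have "eventually (\<lambda>t. dist (err t / t) 0 < \<epsilon>) (at_right 0)"
      using err(1) tendstoD by blast
    then obtain \<delta> where \<delta>: "\<delta> > 0" "\<And>t. 0 < t \<Longrightarrow> t < \<delta> \<Longrightarrow> \<bar>err t / t\<bar> < \<epsilon>"
      unfolding eventually_at_right_field by auto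
    have "b_bound d (v \<bullet> (y - x)) (\<epsilon> * norm (y - x))"
      if *: "x \<in> X" "y \<in> Y" "v \<in> limiting_normal_cone X x \<inter> cball 0 1" "norm (y - x) < \<delta>"
      for x y v
    \<comment> \<open>The limit says nothing about \<open>err 0\<close>, but for
      \<open>y = x\<close> the inner product vanishes.\<close>
    proof (cases "y = x")
      case False
      then have t: "norm (y - x) > 0" by simp
      then have "err (norm (y - x)) / norm (y - x) < \<epsilon>"
        using \<delta>(2)[OF t *(4)] by linarith
      then have "err (norm (y - x)) \<le> \<epsilon> * norm (y - x)"
        using t by (simp add: field_simps)
      then show ?thesis
        using err(2)[OF *(1-3)] by (simp add: b_bound_iff)
    qed (simp add: b_bound_iff)
    then show "\<exists>\<delta>>0. \<forall>x\<in>X. \<forall>y\<in>Y. \<forall>v\<in>limiting_normal_cone X x \<inter> cball 0 1.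
        norm (y - x) < \<delta> \<longrightarrow> b_bound d (v \<bullet> (y - x)) (\<epsilon> * norm (y - x))"
      using \<delta>(1) by blast
  qed
next
  assume r: ?r
  define S where "S t = {b_part d (v \<bullet> (y - x)) | x y v.
    x \<in> X \<and> y \<in> Y \<and> v \<in> limiting_normal_cone X x \<inter> cball 0 1 \<and> norm (y - x) = t}" for t
  \<comment> \<open>Inserting 0 covers distances \<open>t\<close> that no pair attains and makes
    \<open>err\<close> nonnegative, which gives the lower half of the limit.\<close>
  define err where "err t = Sup (insert 0 (S t))" for t
  have S_le: "s \<le> t" if s: "s \<in> S t" for s t
  proof -
    obtain x y v where *: "s = b_part d (v \<bullet> (y - x))" "norm (y - x) = t"
        "v \<in> limiting_normal_cone X x \<inter> cball 0 1"
      using s unfolding S_def by blast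
    have "\<bar>v \<bullet> (y - x)\<bar> \<le> norm v * norm (y - x)"
      by (rule Cauchy_Schwarz_ineq2)
    also have "\<dots> \<le> t"
      using * mult_right_mono[of "norm v" 1 "norm (y - x)"] norm_ge_zero[of "y - x"] by simp
    finally show ?thesis using * b_part_le_abs order_trans by blast
  qed
  have bdd: "bdd_above (insert 0 (S t))" for t
    using bdd_aboveI[of "S t" t] S_le by simp
  show ?l
    unfolding b_regular_def
  proof (intro exI[of _ err] conjI ballI)
    fix x y v assume "x \<in> X" "y \<in> Y" "v \<in> limiting_normal_cone X x \<inter> cball 0 1"
    then have "b_part d (v \<bullet> (y - x)) \<in> S (norm (y - x))"
      unfolding S_def by blast
    then show "b_bound d (v \<bullet> (y - x)) (err (norm (y - x)))"
      unfolding b_bound_iff err_def by (intro cSup_upper bdd) auto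
  next
    show "((\<lambda>t. err t / t) \<longlongrightarrow> 0) (at_right 0)"
    proof (rule tendstoI)
      fix e :: real assume e: "e > 0"
      then have "e / 2 > 0" by simp
      from r[rule_format, OF this] obtain \<delta> where \<delta>: "\<delta> > 0" "\<And>x y v. x \<in> X \<Longrightarrow> y \<in> Y \<Longrightarrow>
          v \<in> limiting_normal_cone X x \<inter> cball 0 1 \<Longrightarrow> norm (y - x) < \<delta> \<Longrightarrow>
          b_bound d (v \<bullet> (y - x)) (e / 2 * norm (y - x))"
        by metis
      have "dist (err t / t) 0 < e" if t: "0 < t" "t < \<delta>" for t
      proof -
        have "s \<le> e / 2 * t" if "s \<in> S t" for s
          using that \<delta>(2) t by (auto simp: S_def b_bound_iff)
        then have "err t \<le> e / 2 * t"
          using e t unfolding err_def by (intro cSup_least) auto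
        moreover have "0 \<le> err t"
          unfolding err_def by (intro cSup_upper bdd) auto
        ultimately have "0 \<le> err t / t" "err t / t \<le> e / 2"
          using t by (simp_all add: field_simps)
        then show ?thesis using e unfolding dist_real_def by linarith
      qed
      then show "eventually (\<lambda>t. dist (err t / t) 0 < e) (at_right 0)"
        unfolding eventually_at_right_field using \<delta>(1) by blast
    qed
  qed
qed

lemma b_regular_Int_open_iff:
  assumes "open U"
  shows "b_regular d (X \<inter> U) (Y \<inter> U) \<longleftrightarrow>
    (\<forall>\<epsilon>>0. \<exists>\<delta>>0. \<forall>x\<in>X \<inter> U. \<forall>y\<in>Y \<inter> U. \<forall>v\<in>limiting_normal_cone X x \<inter> cball 0 1.
      norm (y - x) < \<delta> \<longrightarrow> b_bound d (v \<bullet> (y - x)) (\<epsilon> * norm (y - x)))"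
  unfolding b_regular_iff using limiting_normal_cone_Int_open[OF assms, of _ X] by simp

lemma strongly_b_regular_Int_open_iff:
  assumes "open U"
  shows "strongly_b_regular d (X \<inter> U) (Y \<inter> U) \<longleftrightarrow>
    (\<exists>C>0. \<forall>x\<in>X \<inter> U. \<forall>y\<in>Y \<inter> U. \<forall>v\<in>limiting_normal_cone X x \<inter> cball 0 1.
      b_bound d (v \<bullet> (y - x)) (C * (norm (x - y))\<^sup>2))"
  unfolding strongly_b_regular_def using limiting_normal_cone_Int_open[OF assms, of _ X] by simp

text \<open>Used with \<open>p = y - x\<close> and \<open>q = F y - F x\<close>. Scaling by
  \<open>c\<close> places \<open>v\<close> in the unit ball, where the (b) inequality is available.
  Since \<open>c\<close> is positive it passes through \<open>b_part\<close>, and the linearisation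
  error enters by its absolute value, so all three symbols are handled at once.\<close>

lemma b_bound_adjoint:
  fixes A :: "'w::euclidean_space \<Rightarrow>\<^sub>L 'e::euclidean_space"
  assumes c: "c > 0" and v: "c * norm v \<le> 1"
    and b: "b_bound d ((c *\<^sub>R v) \<bullet> q) e1" and e2: "norm (q - A p) \<le> e2"
  shows "b_bound d (adjoint (blinfun_apply A) v \<bullet> p) ((e1 + e2) / c)"
proof -
  let ?s = "adjoint (blinfun_apply A) v \<bullet> p"
  have "c * ?s = (c *\<^sub>R v) \<bullet> q + (c *\<^sub>R v) \<bullet> (A p - q)"
    by (simp add: inner_adjoint_blinfun inner_diff_right)
  then have "c * b_part d ?s \<le> b_part d ((c *\<^sub>R v) \<bullet> q) + \<bar>(c *\<^sub>R v) \<bullet> (A p - q)\<bar>"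
    using c b_part_add_le by (metis b_part_mult less_imp_le)
  moreover have "\<bar>(c *\<^sub>R v) \<bullet> (A p - q)\<bar> \<le> norm (c *\<^sub>R v) * norm (A p - q)"
    by (rule Cauchy_Schwarz_ineq2)
  moreover have "\<dots> \<le> 1 * norm (A p - q)"
    using c v by (intro mult_right_mono) auto
  ultimately have "c * b_part d ?s \<le> e1 + e2"
    using b e2 by (simp add: b_bound_iff norm_minus_commute)
  then show ?thesis
    using c by (simp add: b_bound_iff field_simps)
qed

section \<open>Local estimates for smooth maps\<close>

text \<open>Mean value inequality with a bound for \<open>g'\<close> on a compact ball. The codomain
  is a general normed space because \<open>g\<close> is \<open>F\<close> in some uses and the
  derivative field in another.\<close>

lemma C1_Lipschitz_on_cball:
  fixes g :: "'w::euclidean_space \<Rightarrow> 'b::real_normed_vector"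
  assumes der: "\<And>x. (g has_derivative blinfun_apply (g' x)) (at x)"
    and cont: "continuous_on UNIV g'"
  shows "\<exists>L>0. \<forall>x\<in>cball a r. \<forall>y\<in>cball a r. norm (g y - g x) \<le> L * norm (y - x)"
proof -
  have "compact (g' ` cball a r)"
    by (intro compact_continuous_image continuous_on_subset[OF cont]) auto
  then obtain L where L: "L > 0" "\<And>x. x \<in> cball a r \<Longrightarrow> norm (g' x) \<le> L"
    using compact_imp_bounded bounded_pos by (metis image_eqI)
  have "norm (g y - g x) \<le> L * norm (y - x)" if "x \<in> cball a r" "y \<in> cball a r" for x y
    by (rule differentiable_bound[of "cball a r" _ "\<lambda>x. blinfun_apply (g' x)"])
      (use that der L in \<open>auto simp: norm_blinfun.rep_eq intro: has_derivative_at_withinI\<close>)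
  then show ?thesis using L(1) by blast
qed

lemma linearization_bound_on_segment:
  fixes F :: "'w::euclidean_space \<Rightarrow> 'b::real_normed_vector"
  assumes der: "\<And>x. (F has_derivative blinfun_apply (F' x)) (at x)"
    and B: "\<And>z. z \<in> closed_segment x y \<Longrightarrow> norm (F' z - F' x) \<le> B"
  shows "norm (F y - F x - F' x (y - x)) \<le> B * norm (y - x)"
proof -
  have "norm (F y - F x - F' x (y - x)) \<le> norm (y - x) * B"
  proof (rule differentiable_bound_linearization)
    show "x + t *\<^sub>R (y - x) \<in> closed_segment x y" if "t \<in> {0..1}" for t
      using that by (auto simp: in_segment algebra_simps intro!: exI[of _ t])
    show "(F has_derivative blinfun_apply (F' z)) (at z within closed_segment x y)" for z
      using der by (rule has_derivative_at_withinI)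
    show "onorm (blinfun_apply (F' z) - blinfun_apply (F' x)) \<le> B" if "z \<in> closed_segment x y" for z
      using B[OF that] by (simp add: norm_blinfun.rep_eq minus_blinfun.rep_eq fun_diff_def)
  qed auto
  then show ?thesis by (simp add: mult.commute)
qed

lemma dist_closed_segment_le:
  fixes x y z :: "'a::euclidean_space"
  assumes "z \<in> closed_segment x y"
  shows "norm (z - x) \<le> norm (y - x)"
  using segment_bound1[OF assms] by simp

text \<open>Uniform continuity of \<open>F'\<close> on the compact ball makes
  \<open>\<delta>\<close> independent of the base point, as a single error function for all
  \<open>x\<close> and \<open>y\<close> demands.\<close>

lemma C1_uniform_linearization:
  fixes F :: "'w::euclidean_space \<Rightarrow> 'b::real_normed_vector"
  assumes der: "\<And>x. (F has_derivative blinfun_apply (F' x)) (at x)"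
    and cont: "continuous_on UNIV F'" and \<epsilon>: "\<epsilon> > 0"
  shows "\<exists>\<delta>>0. \<forall>x\<in>cball a r. \<forall>y\<in>cball a r. norm (y - x) < \<delta> \<longrightarrow>
    norm (F y - F x - F' x (y - x)) \<le> \<epsilon> * norm (y - x)"
proof -
  have "uniformly_continuous_on (cball a r) F'"
    by (intro compact_uniformly_continuous continuous_on_subset[OF cont]) auto
  then obtain \<delta> where \<delta>: "\<delta> > 0"
    "\<And>x z. x \<in> cball a r \<Longrightarrow> z \<in> cball a r \<Longrightarrow> dist z x < \<delta> \<Longrightarrow> dist (F' z) (F' x) < \<epsilon>"
    using \<epsilon> unfolding uniformly_continuous_on_def by metis
  have "norm (F y - F x - F' x (y - x)) \<le> \<epsilon> * norm (y - x)"
    if *: "x \<in> cball a r" "y \<in> cball a r" "norm (y - x) < \<delta>" for x y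
  proof (rule linearization_bound_on_segment[OF der])
    fix z assume z: "z \<in> closed_segment x y"
    then have "z \<in> cball a r"
      using closed_segment_subset[OF *(1,2) convex_cball] by blast
    moreover have "dist z x < \<delta>"
      using dist_closed_segment_le[OF z] *(3) by (simp add: dist_norm)
    ultimately show "norm (F' z - F' x) \<le> \<epsilon>"
      using \<delta>(2)[of x z] * by (simp add: dist_norm)
  qed
  then show ?thesis using \<delta>(1) by blast
qed

lemma quadratic_linearization:
  fixes F :: "'w::euclidean_space \<Rightarrow> 'b::real_normed_vector"
  assumes der: "\<And>x. (F has_derivative blinfun_apply (F' x)) (at x)"
    and Lip: "\<And>x y. x \<in> cball a r \<Longrightarrow> y \<in> cball a r \<Longrightarrow> norm (F' y - F' x) \<le> M * norm (y - x)"
    and M: "M \<ge> 0" and xy: "x \<in> cball a r" "y \<in> cball a r"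
  shows "norm (F y - F x - F' x (y - x)) \<le> M * (norm (y - x))\<^sup>2"
proof -
  have "norm (F y - F x - F' x (y - x)) \<le> (M * norm (y - x)) * norm (y - x)"
  proof (rule linearization_bound_on_segment[OF der])
    fix z assume z: "z \<in> closed_segment x y"
    then have "z \<in> cball a r"
      using closed_segment_subset[OF xy convex_cball] by blast
    then have "norm (F' z - F' x) \<le> M * norm (z - x)"
      using Lip xy by blast
    also have "\<dots> \<le> M * norm (y - x)"
      using dist_closed_segment_le[OF z] M by (rule mult_left_mono)
    finally show "norm (F' z - F' x) \<le> M * norm (y - x)" .
  qed
  then show ?thesis by (simp add: power2_eq_square mult.assoc)
qed

section \<open>Preimages under transversality\<close>

lemma transversality_uniform:
  fixes A :: "'w::euclidean_space \<Rightarrow> 'w \<Rightarrow>\<^sub>L 'e::euclidean_space"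
  assumes cont: "isCont A x0"
    and U: "open U" "y0 \<in> Y \<inter> U" and areg: "a_regular (X \<inter> U) (Y \<inter> U)"
    and trans: "limiting_normal_cone Y y0 \<inter> {w. adjoint (blinfun_apply (A x0)) w = 0} = {0}"
  shows "\<exists>c>0. \<exists>\<delta>>0. \<forall>z\<in>ball x0 \<delta>. \<forall>u\<in>X \<inter> ball y0 \<delta>. \<forall>v\<in>limiting_normal_cone X u.
    c * norm v \<le> norm (adjoint (blinfun_apply (A z)) v)"
proof (rule ccontr)
  assume neg: "\<not> ?thesis"
  obtain \<delta> where \<delta>: "\<delta> > 0" "ball y0 \<delta> \<subseteq> U"
    using U open_contains_ball by (metis IntD2)
  \<comment> \<open>One sequence serves both as radius and as violated constant; the minimum with
    \<open>\<delta>\<close> keeps every \<open>u n\<close> in \<open>U\<close>.\<close>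
  define c where "c n = min \<delta> (inverse (real (Suc n)))" for n
  have c: "c n > 0" "c n \<le> \<delta>" "c n \<le> inverse (real (Suc n))" for n
    using \<delta>(1) by (auto simp: c_def)
  have "\<exists>z u v. z \<in> ball x0 (c n) \<and> u \<in> X \<inter> ball y0 (c n) \<and> v \<in> limiting_normal_cone X u \<and>
      norm (adjoint (blinfun_apply (A z)) v) < c n * norm v" for n
    using neg c(1)[of n] by (meson not_le)
  then obtain z u v where *: "\<And>n. z n \<in> ball x0 (c n)" "\<And>n. u n \<in> X \<inter> ball y0 (c n)"
    "\<And>n. v n \<in> limiting_normal_cone X (u n)"
    "\<And>n. norm (adjoint (blinfun_apply (A (z n))) (v n)) < c n * norm (v n)"
    by metis
  have v0: "v n \<noteq> 0" for n
    using *(4)[of n] by auto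
  define e where "e n = v n /\<^sub>R norm (v n)" for n
  have e: "e n \<in> sphere 0 1" "e n \<in> limiting_normal_cone X (u n)" for n
    using v0 * by (auto simp: e_def intro: limiting_normal_cone_scaleR)
  have small: "norm (adjoint (blinfun_apply (A (z n))) (e n)) \<le> inverse (real (Suc n))" for n
  proof -
    have "norm (adjoint (blinfun_apply (A (z n))) (e n)) < c n"
      using *(4)[of n] v0[of n] by (simp add: e_def adjoint_blinfun_scaleR field_simps)
    then show ?thesis using c(3)[of n] by linarith
  qed
  have "norm (z n - x0) \<le> inverse (real (Suc n))" "norm (u n - y0) \<le> inverse (real (Suc n))" for n
    using *(1,2)[of n] c(3)[of n] by (auto simp: dist_norm norm_minus_commute)
  then have "(\<lambda>n. z n - x0) \<longlonglongrightarrow> 0" "(\<lambda>n. u n - y0) \<longlonglongrightarrow> 0"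
    by (auto intro!: Lim_null_comparison[OF _ LIMSEQ_inverse_real_of_nat] always_eventually)
  then have zu: "z \<longlonglongrightarrow> x0" "u \<longlonglongrightarrow> y0"
    by (simp_all add: LIM_zero_iff)
  have "seq_compact (sphere (0::'e) 1)"
    by (simp add: compact_eq_seq_compact_metric[symmetric])
  then obtain e0 \<sigma> where \<sigma>: "e0 \<in> sphere 0 1" "strict_mono \<sigma>" "(e \<circ> \<sigma>) \<longlonglongrightarrow> e0"
    using e(1) unfolding seq_compact_def by metis
  have lim: "(z \<circ> \<sigma>) \<longlonglongrightarrow> x0" "(u \<circ> \<sigma>) \<longlonglongrightarrow> y0"
    using zu LIMSEQ_subseq_LIMSEQ[OF _ \<sigma>(2)] by blast+
  have "\<forall>n. (u \<circ> \<sigma>) n \<in> X \<inter> U \<and> (e \<circ> \<sigma>) n \<in> limiting_normal_cone X ((u \<circ> \<sigma>) n)"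
    using e(2) *(2) c(2) \<delta>(2) by (fastforce simp: subset_iff intro: less_le_trans)
  then have "e0 \<in> limiting_normal_cone Y y0"
    using areg \<sigma>(3) lim(2) U unfolding a_regular_Int_open_iff[OF U(1)] by blast
  moreover have "(\<lambda>n. adjoint (blinfun_apply (A ((z \<circ> \<sigma>) n))) ((e \<circ> \<sigma>) n)) \<longlonglongrightarrow>
      adjoint (blinfun_apply (A x0)) e0"
    by (intro tendsto_adjoint_blinfun isCont_tendsto_compose[OF cont] lim \<sigma>)
  moreover have "(\<lambda>n. adjoint (blinfun_apply (A (z n))) (e n)) \<longlonglongrightarrow> 0"
    using small by (auto intro!: Lim_null_comparison[OF _ LIMSEQ_inverse_real_of_nat] always_eventually)
  then have "(\<lambda>n. adjoint (blinfun_apply (A ((z \<circ> \<sigma>) n))) ((e \<circ> \<sigma>) n)) \<longlonglongrightarrow> 0"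
    using LIMSEQ_subseq_LIMSEQ[OF _ \<sigma>(2)] by (fastforce simp: o_def)
  ultimately have "e0 \<in> limiting_normal_cone Y y0 \<inter> {w. adjoint (blinfun_apply (A x0)) w = 0}"
    using LIMSEQ_unique by blast
  then show False using trans \<sigma>(1) by auto
qed

text \<open>\<open>F'\<close> is a field of operators, continuous in the operator norm. C^2
  smoothness is later used only as a Lipschitz bound on this \<open>F'\<close> over the unit ball
  about \<open>x0\<close>.\<close>

locale transversal_preimage =
  fixes F :: "'w::euclidean_space \<Rightarrow> 'e::euclidean_space"
    and F' :: "'w \<Rightarrow> 'w \<Rightarrow>\<^sub>L 'e" and x0 :: 'w and X Y :: "'e set"
  assumes der: "\<And>x. (F has_derivative blinfun_apply (F' x)) (at x)"
    and cont: "continuous_on UNIV F'"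
    and lc: "locally closed X"
    and reg: "clarke_regular Y"
    and base: "F x0 \<in> Y"
    and trans: "limiting_normal_cone Y (F x0) \<inter> {w. adjoint (blinfun_apply (F' x0)) w = 0} = {0}"
begin

abbreviation adj :: "'w \<Rightarrow> 'e \<Rightarrow> 'w" where
  "adj x \<equiv> adjoint (blinfun_apply (F' x))"

lemma isCont_F: "isCont F x"
  using der has_derivative_continuous by blast

lemma isCont_F': "isCont F' x"
  using cont by (simp add: continuous_on_eq_continuous_at)

lemma adj_normal_preimage:
  assumes "F y \<in> Y" "v \<in> limiting_normal_cone Y (F y)"
  shows "adj y v \<in> limiting_normal_cone (F -` Y) y"
proof -
  have "v \<in> frechet_normal_cone Y (F y)"
    using assms limiting_eq_frechet_if_clarke_regular[OF reg] by blast
  then have "adj y v \<in> frechet_normal_cone (F -` Y) y"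
    by (rule adjoint_frechet_normal_preimage[OF der])
  then show ?thesis using assms(1) frechet_subset_limiting by blast
qed

text \<open>One constant \<open>c\<close> and one ball on which every normal of the preimage has a
  controlled lift. \<open>W\<close> is meant for the neighbourhood where the condition to be
  transferred holds; \<open>\<rho> \<le> 1\<close> keeps the ball inside the unit ball of the
  Lipschitz and linearisation bounds.\<close>

lemma normals_lift:
  assumes "holds_near a_regular X Y (F x0)" "open W" "F x0 \<in> W"
  obtains c \<rho> where "c > 0" "\<rho> > 0" "\<rho> \<le> 1" "F ` ball x0 \<rho> \<subseteq> W"
    "\<And>x w. x \<in> ball x0 \<rho> \<Longrightarrow> F x \<in> X \<Longrightarrow> w \<in> limiting_normal_cone (F -` X) x \<Longrightarrow>
      \<exists>v\<in>limiting_normal_cone X (F x). w = adj x v \<and> c * norm v \<le> norm w"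
proof -
  obtain U where U: "open U" "F x0 \<in> U" "a_regular (X \<inter> U) (Y \<inter> U)"
    using assms(1) unfolding holds_near_def by blast
  obtain c \<delta> where c: "c > 0" "\<delta> > 0" and qual: "\<And>z u v. z \<in> ball x0 \<delta> \<Longrightarrow>
      u \<in> X \<inter> ball (F x0) \<delta> \<Longrightarrow> v \<in> limiting_normal_cone X u \<Longrightarrow> c * norm v \<le> norm (adj z v)"
    using transversality_uniform[OF isCont_F' U(1) _ U(3) trans] U(2) base by blast
  \<comment> \<open>Half radii leave room: balls of radius \<open>\<delta> / 2\<close> about
    \<open>x\<close> and \<open>F x\<close> stay inside those of radius \<open>\<delta>\<close>
    about \<open>x0\<close> and \<open>F x0\<close>, where the lower bound holds.\<close>
  have "eventually (\<lambda>x. F x \<in> W \<inter> ball (F x0) (\<delta> / 2)) (nhds x0)"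
    using isCont_F[of x0] assms(2,3) c(2)
    by (intro topological_tendstoD) (auto simp: isCont_def tendsto_at_iff_tendsto_nhds)
  then obtain \<rho>0 where \<rho>0: "\<rho>0 > 0" "\<And>x. dist x x0 < \<rho>0 \<Longrightarrow> F x \<in> W \<inter> ball (F x0) (\<delta> / 2)"
    unfolding eventually_nhds_metric by blast
  define \<rho> where "\<rho> = min 1 (min \<rho>0 (\<delta> / 2))"
  have \<rho>: "\<rho> > 0" "\<rho> \<le> 1" "\<rho> \<le> \<rho>0" "\<rho> \<le> \<delta> / 2"
    using \<rho>0(1) c(2) by (auto simp: \<rho>_def)
  have lift: "\<exists>v\<in>limiting_normal_cone X (F x). w = adj x v \<and> c * norm v \<le> norm w"
    if x: "x \<in> ball x0 \<rho>" "F x \<in> X" and w: "w \<in> limiting_normal_cone (F -` X) x" for x w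
  proof -
    have Fx: "dist (F x0) (F x) < \<delta> / 2"
      using \<rho>0(2)[of x] x \<rho> by (auto simp: dist_commute)
    have "\<exists>v\<in>limiting_normal_cone X (F x). w = adj x v"
    proof (rule limiting_normal_preimage[OF der isCont_F' lc c(1) _ _ w])
      show "\<delta> / 2 > 0" using c by simp
      fix z u v assume *: "z \<in> ball x (\<delta> / 2)" "u \<in> X \<inter> ball (F x) (\<delta> / 2)"
        "v \<in> limiting_normal_cone X u"
      have "z \<in> ball x0 \<delta>"
        using * x \<rho> dist_triangle[of x0 z x] by auto
      moreover have "u \<in> X \<inter> ball (F x0) \<delta>"
        using * Fx dist_triangle[of "F x0" u "F x"] by auto
      ultimately show "c * norm v \<le> norm (adj z v)"
        using qual * by blast
    qed
    then obtain v where v: "v \<in> limiting_normal_cone X (F x)" "w = adj x v" by blast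
    moreover have "c * norm v \<le> norm (adj x v)"
      using x \<rho> Fx c v(1) by (intro qual) auto
    ultimately show ?thesis by blast
  qed
  show thesis
    by (rule that[OF c(1) \<rho>(1,2) _ lift]) (use \<rho>0(2) \<rho> in \<open>auto simp: dist_commute\<close>)
qed

section \<open>Transfer of the regularity conditions to preimages\<close>

text \<open>Convergence of \<open>ws\<close> bounds the lifts by \<open>M / c\<close>, so some
  subsequence of them converges. (a)-regularity puts its limit into the cone of \<open>Y\<close> at
  \<open>F y\<close>, and continuity of \<open>F'\<close> identifies the adjoint image of that limit
  with \<open>w\<close>.\<close>

lemma a_regular_preimage:
  assumes "holds_near a_regular X Y (F x0)"
  shows "holds_near a_regular (F -` X) (F -` Y) x0"
proof -
  obtain U where U: "open U" "F x0 \<in> U" "a_regular (X \<inter> U) (Y \<inter> U)"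
    using assms unfolding holds_near_def by blast
  obtain c \<rho> where c: "c > 0" "\<rho> > 0" "\<rho> \<le> 1" "F ` ball x0 \<rho> \<subseteq> U"
    "\<And>x w. x \<in> ball x0 \<rho> \<Longrightarrow> F x \<in> X \<Longrightarrow> w \<in> limiting_normal_cone (F -` X) x \<Longrightarrow>
      \<exists>v\<in>limiting_normal_cone X (F x). w = adj x v \<and> c * norm v \<le> norm w"
    using normals_lift[OF assms U(1,2)] by metis
  have "a_regular (F -` X \<inter> ball x0 \<rho>) (F -` Y \<inter> ball x0 \<rho>)"
    unfolding a_regular_Int_open_iff[OF open_ball]
  proof safe
    fix xs :: "nat \<Rightarrow> 'w" and ws y w
    assume *: "\<forall>i. xs i \<in> F -` X \<inter> ball x0 \<rho> \<and> ws i \<in> limiting_normal_cone (F -` X) (xs i)"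
      "F y \<in> Y" "y \<in> ball x0 \<rho>" "xs \<longlonglongrightarrow> y" "ws \<longlonglongrightarrow> w"
    then have "\<forall>i. \<exists>v\<in>limiting_normal_cone X (F (xs i)). ws i = adj (xs i) v \<and>
        c * norm v \<le> norm (ws i)"
      using c(5) by blast
    then obtain v where v: "\<And>i. v i \<in> limiting_normal_cone X (F (xs i))"
      "\<And>i. ws i = adj (xs i) (v i)" "\<And>i. c * norm (v i) \<le> norm (ws i)"
      by metis
    obtain M where M: "\<And>i. norm (ws i) \<le> M"
      using convergent_imp_Bseq[OF convergentI[OF *(5)]] by (auto simp: Bseq_def)
    have "norm (v i) \<le> M / c" for i
      using order_trans[OF v(3) M, of i] c(1) by (simp add: field_simps)
    then have "bounded (range v)"
      by (auto simp: bounded_iff)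
    then obtain v0 \<sigma> where \<sigma>: "strict_mono \<sigma>" "(v \<circ> \<sigma>) \<longlonglongrightarrow> v0"
      using bounded_imp_convergent_subsequence by blast
    have lim: "(xs \<circ> \<sigma>) \<longlonglongrightarrow> y" "(ws \<circ> \<sigma>) \<longlonglongrightarrow> w"
      using *(4,5) LIMSEQ_subseq_LIMSEQ[OF _ \<sigma>(1)] by blast+
    have "(\<lambda>i. F ((xs \<circ> \<sigma>) i)) \<longlonglongrightarrow> F y"
      by (rule isCont_tendsto_compose[OF isCont_F lim(1)])
    moreover have "\<forall>i. F ((xs \<circ> \<sigma>) i) \<in> X \<inter> U \<and>
        (v \<circ> \<sigma>) i \<in> limiting_normal_cone X (F ((xs \<circ> \<sigma>) i))"
      using v(1) * c(4) by (auto simp: image_subset_iff)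
    moreover have "F y \<in> Y \<inter> U" using * c(4) by auto
    ultimately have "v0 \<in> limiting_normal_cone Y (F y)"
      using U(3)[unfolded a_regular_Int_open_iff[OF U(1)], rule_format,
          of "\<lambda>i. F ((xs \<circ> \<sigma>) i)" "v \<circ> \<sigma>" "F y" v0] \<sigma>(2) by blast
    then have "adj y v0 \<in> limiting_normal_cone (F -` Y) y"
      using * adj_normal_preimage by blast
    moreover have "(\<lambda>i. adj ((xs \<circ> \<sigma>) i) ((v \<circ> \<sigma>) i)) \<longlonglongrightarrow> adj y v0"
      by (intro tendsto_adjoint_blinfun isCont_tendsto_compose[OF isCont_F'] lim \<sigma>)
    then have "w = adj y v0"
      using lim(2) v(2) by (intro LIMSEQ_unique[of _ w]) (auto simp: o_def)
    ultimately show "w \<in> limiting_normal_cone (F -` Y) y" by simp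
  qed
  then show ?thesis
    unfolding holds_near_def using c(2) by (intro exI[of _ "ball x0 \<rho>"]) auto
qed

lemma b_regular_preimage:
  assumes "holds_near a_regular X Y (F x0)" "holds_near (b_regular d) X Y (F x0)"
  shows "holds_near (b_regular d) (F -` X) (F -` Y) x0"
proof -
  obtain U where U: "open U" "F x0 \<in> U" "b_regular d (X \<inter> U) (Y \<inter> U)"
    using assms(2) unfolding holds_near_def by blast
  obtain c \<rho> where c: "c > 0" "\<rho> > 0" "\<rho> \<le> 1" "F ` ball x0 \<rho> \<subseteq> U"
    "\<And>x w. x \<in> ball x0 \<rho> \<Longrightarrow> F x \<in> X \<Longrightarrow> w \<in> limiting_normal_cone (F -` X) x \<Longrightarrow>
      \<exists>v\<in>limiting_normal_cone X (F x). w = adj x v \<and> c * norm v \<le> norm w"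
    using normals_lift[OF assms(1) U(1,2)] by metis
  obtain L where L: "L > 0"
    "\<And>x y. x \<in> cball x0 1 \<Longrightarrow> y \<in> cball x0 1 \<Longrightarrow> norm (F y - F x) \<le> L * norm (y - x)"
    using C1_Lipschitz_on_cball[OF der cont] by metis
  have "b_regular d (F -` X \<inter> ball x0 \<rho>) (F -` Y \<inter> ball x0 \<rho>)"
    unfolding b_regular_Int_open_iff[OF open_ball]
  proof (intro allI impI)
    fix \<epsilon> :: real assume \<epsilon>: "\<epsilon> > 0"
    \<comment> \<open>Passing from \<open>F y - F x\<close> to \<open>y - x\<close> costs the (b)
      error a factor \<open>L\<close>, and both errors are divided by \<open>c\<close>, so each
      contributes at most \<open>\<epsilon> / 2 * norm (y - x)\<close>.\<close>
    then have "c * \<epsilon> / (2 * L) > 0" "c * \<epsilon> / 2 > 0" using c L by auto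
    obtain \<delta>1 where \<delta>1: "\<delta>1 > 0" "\<And>x y v. x \<in> X \<inter> U \<Longrightarrow> y \<in> Y \<inter> U \<Longrightarrow>
        v \<in> limiting_normal_cone X x \<inter> cball 0 1 \<Longrightarrow> norm (y - x) < \<delta>1 \<Longrightarrow>
        b_bound d (v \<bullet> (y - x)) (c * \<epsilon> / (2 * L) * norm (y - x))"
      using U(3) \<open>c * \<epsilon> / (2 * L) > 0\<close> unfolding b_regular_Int_open_iff[OF U(1)] by meson
    obtain \<delta>2 where \<delta>2: "\<delta>2 > 0"
      "\<And>x y. x \<in> cball x0 1 \<Longrightarrow> y \<in> cball x0 1 \<Longrightarrow> norm (y - x) < \<delta>2 \<Longrightarrow>
        norm (F y - F x - F' x (y - x)) \<le> c * \<epsilon> / 2 * norm (y - x)"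
      using C1_uniform_linearization[OF der cont \<open>c * \<epsilon> / 2 > 0\<close>] by metis
    have "b_bound d (w \<bullet> (y - x)) (\<epsilon> * norm (y - x))"
      if *: "x \<in> F -` X \<inter> ball x0 \<rho>" "y \<in> F -` Y \<inter> ball x0 \<rho>"
        "w \<in> limiting_normal_cone (F -` X) x \<inter> cball 0 1" "norm (y - x) < min (\<delta>1 / L) \<delta>2" for x y w
    proof -
      obtain v where v: "v \<in> limiting_normal_cone X (F x)" "w = adj x v" "c * norm v \<le> norm w"
        using c(5)[of x w] * by auto
      have v1: "c * norm v \<le> 1" using v(3) *(3) by auto
      have xy: "x \<in> cball x0 1" "y \<in> cball x0 1" using * c(3) by auto
      have Lip: "norm (F y - F x) \<le> L * norm (y - x)" using L(2) xy by blast
      also have "\<dots> < \<delta>1" using *(4) L(1) by (simp add: field_simps)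
      finally have "b_bound d ((c *\<^sub>R v) \<bullet> (F y - F x)) (c * \<epsilon> / (2 * L) * norm (F y - F x))"
        using * c(1,4) v(1) v1 by (intro \<delta>1(2)) (auto intro: limiting_normal_cone_scaleR)
      moreover have "norm (F y - F x - F' x (y - x)) \<le> c * \<epsilon> / 2 * norm (y - x)"
        using \<delta>2(2) xy *(4) by simp
      ultimately have "b_bound d (w \<bullet> (y - x))
          ((c * \<epsilon> / (2 * L) * norm (F y - F x) + c * \<epsilon> / 2 * norm (y - x)) / c)"
        unfolding v(2) by (rule b_bound_adjoint[OF c(1) v1])
      moreover have "c * \<epsilon> / (2 * L) * norm (F y - F x) \<le> c * \<epsilon> / (2 * L) * (L * norm (y - x))"
        using Lip \<open>c * \<epsilon> / (2 * L) > 0\<close> by (intro mult_left_mono) auto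
      then have "(c * \<epsilon> / (2 * L) * norm (F y - F x) + c * \<epsilon> / 2 * norm (y - x)) / c
          \<le> \<epsilon> * norm (y - x)"
        using c(1) L(1) by (simp add: field_simps)
      ultimately show ?thesis by (simp add: b_bound_iff)
    qed
    then show "\<exists>\<delta>>0. \<forall>x\<in>F -` X \<inter> ball x0 \<rho>. \<forall>y\<in>F -` Y \<inter> ball x0 \<rho>.
        \<forall>w\<in>limiting_normal_cone (F -` X) x \<inter> cball 0 1.
          norm (y - x) < \<delta> \<longrightarrow> b_bound d (w \<bullet> (y - x)) (\<epsilon> * norm (y - x))"
      using \<delta>1(1) \<delta>2(1) L(1) by (intro exI[of _ "min (\<delta>1 / L) \<delta>2"]) auto
  qed
  then show ?thesis
    unfolding holds_near_def using c(2) by (intro exI[of _ "ball x0 \<rho>"]) auto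
qed

lemma strongly_a_regular_preimage:
  assumes "holds_near strongly_a_regular X Y (F x0)"
    and M: "M > 0" "\<And>x y. x \<in> cball x0 1 \<Longrightarrow> y \<in> cball x0 1 \<Longrightarrow>
      norm (F' y - F' x) \<le> M * norm (y - x)"
  shows "holds_near strongly_a_regular (F -` X) (F -` Y) x0"
proof -
  obtain U where U: "open U" "F x0 \<in> U" "strongly_a_regular (X \<inter> U) (Y \<inter> U)"
    using assms(1) unfolding holds_near_def by blast
  then have "holds_near a_regular X Y (F x0)"
    unfolding holds_near_def using strongly_a_regular_imp_a_regular by blast
  then obtain c \<rho> where c: "c > 0" "\<rho> > 0" "\<rho> \<le> 1" "F ` ball x0 \<rho> \<subseteq> U"
    "\<And>x w. x \<in> ball x0 \<rho> \<Longrightarrow> F x \<in> X \<Longrightarrow> w \<in> limiting_normal_cone (F -` X) x \<Longrightarrow>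
      \<exists>v\<in>limiting_normal_cone X (F x). w = adj x v \<and> c * norm v \<le> norm w"
    using normals_lift[OF _ U(1,2)] by metis
  obtain C where C: "C > 0" "\<And>x y u. x \<in> X \<inter> U \<Longrightarrow> y \<in> Y \<inter> U \<Longrightarrow>
      u \<in> limiting_normal_cone X x \<Longrightarrow>
      \<exists>v\<in>limiting_normal_cone Y y. norm (u - v) \<le> C * norm (x - y) * norm u"
    using U(3) unfolding strongly_a_regular_Int_open_iff[OF U(1)] by blast
  obtain L where L: "L > 0"
    "\<And>x y. x \<in> cball x0 1 \<Longrightarrow> y \<in> cball x0 1 \<Longrightarrow> norm (F y - F x) \<le> L * norm (y - x)"
    using C1_Lipschitz_on_cball[OF der cont] by metis
  define K where "K = norm (F' x0) + M"
  have K: "norm (F' y) \<le> K" if "y \<in> cball x0 1" for y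
  proof -
    have "norm (F' y - F' x0) \<le> M * norm (y - x0)" using M that by auto
    also have "\<dots> \<le> M * 1"
      using that M(1) by (intro mult_left_mono) (auto simp: dist_norm norm_minus_commute)
    finally show ?thesis
      using norm_triangle_ineq[of "F' x0" "F' y - F' x0"] by (simp add: K_def)
  qed
  have K0: "K > 0" using M(1) by (simp add: K_def add_nonneg_pos)
  \<comment> \<open>\<open>M\<close> comes from moving the adjoint from \<open>x\<close> to
    \<open>y\<close>, \<open>K * C * L\<close> from replacing \<open>v\<close> by a normal
    \<open>v'\<close> of \<open>Y\<close> at \<open>F y\<close>, and \<open>1 / c\<close> from
    \<open>norm v \<le> norm w / c\<close>.\<close>
  let ?D = "(M + K * C * L) / c"
  have D: "\<exists>w'\<in>limiting_normal_cone (F -` Y) y. norm (w - w') \<le> ?D * norm (x - y) * norm w"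
    if *: "x \<in> F -` X \<inter> ball x0 \<rho>" "y \<in> F -` Y \<inter> ball x0 \<rho>"
      "w \<in> limiting_normal_cone (F -` X) x" for x y w
  proof -
    obtain v where v: "v \<in> limiting_normal_cone X (F x)" "w = adj x v" "c * norm v \<le> norm w"
      using c(5)[of x w] * by auto
    have xy: "x \<in> cball x0 1" "y \<in> cball x0 1" using * c(3) by auto
    obtain v' where v': "v' \<in> limiting_normal_cone Y (F y)"
      "norm (v - v') \<le> C * norm (F x - F y) * norm v"
      using C(2)[of "F x" "F y" v] * c(4) v(1) by (auto simp: image_subset_iff)
    have "norm (v - v') \<le> C * (L * norm (x - y)) * norm v"
      using v'(2) L(2)[OF xy(2,1)] C(1)
      by (meson order_trans mult_left_mono mult_right_mono norm_ge_zero less_imp_le)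
    have "norm (w - adj y v') \<le> norm (F' x - F' y) * norm v + norm (F' y) * norm (v - v')"
      unfolding v(2) adjoint_blinfun_diff
      by (rule norm_triangle_le) (intro add_mono norm_adjoint_blinfun_le)
    also have "\<dots> \<le> (M * norm (x - y)) * norm v + K * (C * (L * norm (x - y)) * norm v)"
      using M(1) M(2)[OF xy(2,1)] K[OF xy(2)] K0 \<open>norm (v - v') \<le> C * (L * norm (x - y)) * norm v\<close>
      by (intro add_mono mult_mono) auto
    also have "\<dots> = ((M + K * C * L) * norm (x - y)) * norm v"
      by (simp add: algebra_simps)
    also have "\<dots> \<le> ((M + K * C * L) * norm (x - y)) * (norm w / c)"
      using v(3) c(1) M(1) K0 C(1) L(1) by (intro mult_left_mono) (auto simp: field_simps)
    also have "\<dots> = ?D * norm (x - y) * norm w"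
      by simp
    finally show ?thesis
      using adj_normal_preimage v'(1) *(2) by blast
  qed
  have "?D > 0" using M(1) K0 C(1) L(1) c(1) by (simp add: add_pos_pos)
  then have "strongly_a_regular (F -` X \<inter> ball x0 \<rho>) (F -` Y \<inter> ball x0 \<rho>)"
    unfolding strongly_a_regular_Int_open_iff[OF open_ball] using D by blast
  then show ?thesis
    unfolding holds_near_def using c(2) by (intro exI[of _ "ball x0 \<rho>"]) auto
qed

lemma strongly_b_regular_preimage:
  assumes "holds_near a_regular X Y (F x0)" "holds_near (strongly_b_regular d) X Y (F x0)"
    and M: "M > 0" "\<And>x y. x \<in> cball x0 1 \<Longrightarrow> y \<in> cball x0 1 \<Longrightarrow>
      norm (F' y - F' x) \<le> M * norm (y - x)"
  shows "holds_near (strongly_b_regular d) (F -` X) (F -` Y) x0"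
proof -
  obtain U where U: "open U" "F x0 \<in> U" "strongly_b_regular d (X \<inter> U) (Y \<inter> U)"
    using assms(2) unfolding holds_near_def by blast
  obtain c \<rho> where c: "c > 0" "\<rho> > 0" "\<rho> \<le> 1" "F ` ball x0 \<rho> \<subseteq> U"
    "\<And>x w. x \<in> ball x0 \<rho> \<Longrightarrow> F x \<in> X \<Longrightarrow> w \<in> limiting_normal_cone (F -` X) x \<Longrightarrow>
      \<exists>v\<in>limiting_normal_cone X (F x). w = adj x v \<and> c * norm v \<le> norm w"
    using normals_lift[OF assms(1) U(1,2)] by metis
  obtain L where L: "L > 0"
    "\<And>x y. x \<in> cball x0 1 \<Longrightarrow> y \<in> cball x0 1 \<Longrightarrow> norm (F y - F x) \<le> L * norm (y - x)"
    using C1_Lipschitz_on_cball[OF der cont] by metis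
  obtain C where C: "C > 0" "\<And>x y v. x \<in> X \<inter> U \<Longrightarrow> y \<in> Y \<inter> U \<Longrightarrow>
      v \<in> limiting_normal_cone X x \<inter> cball 0 1 \<Longrightarrow>
      b_bound d (v \<bullet> (y - x)) (C * (norm (x - y))\<^sup>2)"
    using U(3) unfolding strongly_b_regular_Int_open_iff[OF U(1)] by blast
  \<comment> \<open>\<open>C * L\<^sup>2\<close> is the (b) error after the Lipschitz estimate for
    \<open>F\<close>, \<open>M\<close> the quadratic linearisation error, \<open>1 / c\<close> the
    rescaling of the lift.\<close>
  let ?D = "(C * L\<^sup>2 + M) / c"
  have D: "b_bound d (w \<bullet> (y - x)) (?D * (norm (x - y))\<^sup>2)"
    if *: "x \<in> F -` X \<inter> ball x0 \<rho>" "y \<in> F -` Y \<inter> ball x0 \<rho>"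
      "w \<in> limiting_normal_cone (F -` X) x \<inter> cball 0 1" for x y w
  proof -
    obtain v where v: "v \<in> limiting_normal_cone X (F x)" "w = adj x v" "c * norm v \<le> norm w"
      using c(5)[of x w] * by auto
    have v1: "c * norm v \<le> 1" using v(3) *(3) by auto
    have xy: "x \<in> cball x0 1" "y \<in> cball x0 1" using * c(3) by auto
    have "b_bound d ((c *\<^sub>R v) \<bullet> (F y - F x)) (C * (norm (F x - F y))\<^sup>2)"
      using * c(1,4) v(1) v1 by (intro C(2)) (auto intro: limiting_normal_cone_scaleR)
    moreover have "norm (F y - F x - F' x (y - x)) \<le> M * (norm (y - x))\<^sup>2"
      using M xy by (intro quadratic_linearization[OF der]) auto
    ultimately have "b_bound d (w \<bullet> (y - x))
        ((C * (norm (F x - F y))\<^sup>2 + M * (norm (y - x))\<^sup>2) / c)"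
      unfolding v(2) by (rule b_bound_adjoint[OF c(1) v1])
    moreover have "(norm (F x - F y))\<^sup>2 \<le> (L * norm (x - y))\<^sup>2"
      using L(2)[OF xy(2,1)] by (intro power_mono) auto
    then have "C * (norm (F x - F y))\<^sup>2 \<le> C * (L\<^sup>2 * (norm (x - y))\<^sup>2)"
      using C(1) by (simp add: power_mult_distrib)
    then have "C * (norm (F x - F y))\<^sup>2 + M * (norm (y - x))\<^sup>2 \<le>
        (C * L\<^sup>2 + M) * (norm (x - y))\<^sup>2"
      by (simp add: algebra_simps norm_minus_commute)
    then have "(C * (norm (F x - F y))\<^sup>2 + M * (norm (y - x))\<^sup>2) / c \<le> ?D * (norm (x - y))\<^sup>2"
      using c(1) by (simp add: divide_right_mono)
    ultimately show ?thesis by (simp add: b_bound_iff)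
  qed
  have "?D > 0" using M(1) C(1) c(1) by (simp add: add_nonneg_pos)
  then have "strongly_b_regular d (F -` X \<inter> ball x0 \<rho>) (F -` Y \<inter> ball x0 \<rho>)"
    unfolding strongly_b_regular_Int_open_iff[OF open_ball] using D by blast
  then show ?thesis
    unfolding holds_near_def using c(2) by (intro exI[of _ "ball x0 \<rho>"]) auto
qed

end

section \<open>Second-order smoothness and the conclusion\<close>

text \<open>The derivative field inside \<open>C2_map\<close> is a priori a different one;
  uniqueness of derivatives identifies it with \<open>F'\<close>, and \<open>M\<close> comes from a
  bound on the second derivative over the ball.\<close>

lemma C2_map_derivative_Lipschitz:
  fixes F :: "'w::euclidean_space \<Rightarrow> 'e::euclidean_space"
  assumes "C2_map F" and der: "\<And>x. (F has_derivative blinfun_apply (F' x)) (at x)"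
  obtains M where "M > 0"
    "\<And>x y. x \<in> cball a r \<Longrightarrow> y \<in> cball a r \<Longrightarrow> norm (F' y - F' x) \<le> M * norm (y - x)"
proof -
  obtain G G' where G: "\<And>x. (F has_derivative blinfun_apply (G x)) (at x)"
    "\<And>x. (G has_derivative blinfun_apply (G' x)) (at x)" "continuous_on UNIV G'"
    using assms(1) unfolding C2_map_def by blast
  have "F' = G"
    using has_derivative_unique[OF der G(1)] by (auto simp: blinfun_apply_inject)
  then show thesis
    using C1_Lipschitz_on_cball[OF G(2,3)] that by metis
qed

theorem theorem3p17:
  fixes F :: "'w::euclidean_space \<Rightarrow> 'e::euclidean_space"
    and xbar :: 'w
    and X Y :: "'e set"
    and d :: b_symbol
  assumes "C1_map F"
    and "locally closed X"
    and "locally closed Y"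
    and "clarke_regular Y"
    and "F xbar \<in> Y"
    and "limiting_normal_cone Y (F xbar)
           \<inter> {w. adjoint (frechet_derivative F (at xbar)) w = 0} = {0}"
  shows "(holds_near a_regular X Y (F xbar)
            \<longrightarrow> holds_near a_regular (F -` X) (F -` Y) xbar) \<and>
         (holds_near a_regular X Y (F xbar) \<and> holds_near (b_regular d) X Y (F xbar)
            \<longrightarrow> holds_near (b_regular d) (F -` X) (F -` Y) xbar) \<and>
         (C2_map F \<longrightarrow>
            (holds_near strongly_a_regular X Y (F xbar)
               \<longrightarrow> holds_near strongly_a_regular (F -` X) (F -` Y) xbar) \<and>
            (holds_near a_regular X Y (F xbar) \<and> holds_near (strongly_b_regular d) X Y (F xbar)
               \<longrightarrow> holds_near (strongly_b_regular d) (F -` X) (F -` Y) xbar))"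
proof -
  obtain F' where F': "\<And>x. (F has_derivative blinfun_apply (F' x)) (at x)" "continuous_on UNIV F'"
    using assms(1) unfolding C1_map_def by blast
  \<comment> \<open>Brings the transversality hypothesis into the form with \<open>F' xbar\<close>
    that the locale expects.\<close>
  have "frechet_derivative F (at xbar) = blinfun_apply (F' xbar)"
    using frechet_derivative_at[OF F'(1)] by simp
  then interpret transversal_preimage F F' xbar X Y
    using F' assms by unfold_locales auto
  show ?thesis
  proof (intro conjI impI)
    assume C2: "C2_map F"
    obtain M where M: "M > 0" "\<And>x y. x \<in> cball xbar 1 \<Longrightarrow> y \<in> cball xbar 1 \<Longrightarrow>
        norm (F' y - F' x) \<le> M * norm (y - x)"
      using C2_map_derivative_Lipschitz[OF C2 F'(1)] by blast
    show "holds_near strongly_a_regular (F -` X) (F -` Y) xbar"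
      if "holds_near strongly_a_regular X Y (F xbar)"
      using that M by (rule strongly_a_regular_preimage)
    show "holds_near (strongly_b_regular d) (F -` X) (F -` Y) xbar"
      if "holds_near a_regular X Y (F xbar) \<and> holds_near (strongly_b_regular d) X Y (F xbar)"
      using that M strongly_b_regular_preimage by blast
  qed (use a_regular_preimage b_regular_preimage in blast)+
qed

end
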